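(* For every integer $n \geq 1$, there exists a cyclically $5$-edge-connected snark $H_n$ with exactly $40n+2$ vertices such that $r(H_n) = 2$ and $r_f(H_n) = n$.
   Context: A snark is a $2$-connected cubic graph that admits no proper $3$-edge-coloring. For a set $X \subseteq V(G)$, $\partial_G(X)$ denotes the set of edges with exactly one end in $X$; such an edge-cut is cyclic if both the subgraph induced by $X$ and the subgraph induced by $V(G)\setminus X$ contain a cycle. A graph is cyclically $k$-edge-connected if it has no cyclic edge-cut with fewer than $k$ edges. The resistance $r(G)$ of a cubic graph $G$ is the minimum number of edges whose removal leaves a $3$-edge-colorable graph. A $\mathbb{Z}_2\times\mathbb{Z}_2$-flow on $G$ is a map $f\colon E(G)\to \mathbb{Z}_2\times\mathbb{Z}_2$ such that at every vertex the sum of the values on the incident edges is $0$ (orientations are irrelevant in this group); it is nowhere-zero if $f(e)\neq 0$ for all $e$. The flow resistance $r_f(G)$ is the minimum number of edges whose removal leaves a graph admitting a nowhere-zero $\mathbb{Z}_2\times\mathbb{Z}_2$-flow. *)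

theory Defs
  imports Main "HOL-Library.Z2" "HOL-Library.Product_Plus"
begin

text \<open>
  Finite simple graphs, with edges as two-element vertex sets.  Allowing loops and parallel
  edges would not change which graphs are cyclically 5-edge-connected and cubic, once there are
  at least six vertices: a loop or a pair of parallel edges would be a cycle separated by at
  most two edges from a part that again contains a cycle.
\<close>

record 'a ugraph =
  verts :: "'a set"
  edges :: "'a set set"

definition simple_graph :: "'a ugraph \<Rightarrow> bool" where
  "simple_graph G \<longleftrightarrow> finite (verts G) \<and> (\<forall>e\<in>edges G. e \<subseteq> verts G \<and> card e = 2)"

definition incident_edges :: "'a ugraph \<Rightarrow> 'a \<Rightarrow> 'a set set" where
  "incident_edges G v = {e \<in> edges G. v \<in> e}"

definition cubic :: "'a ugraph \<Rightarrow> bool" where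
  "cubic G \<longleftrightarrow> (\<forall>v\<in>verts G. card (incident_edges G v) = 3)"

definition induced_subgraph :: "'a ugraph \<Rightarrow> 'a set \<Rightarrow> 'a ugraph" where
  "induced_subgraph G X = \<lparr>verts = verts G \<inter> X, edges = {e \<in> edges G. e \<subseteq> X}\<rparr>"

definition delete_edges :: "'a ugraph \<Rightarrow> 'a set set \<Rightarrow> 'a ugraph" where
  "delete_edges G F = \<lparr>verts = verts G, edges = edges G - F\<rparr>"

definition adjacent :: "'a ugraph \<Rightarrow> 'a \<Rightarrow> 'a \<Rightarrow> bool" where
  "adjacent G u v \<longleftrightarrow> {u, v} \<in> edges G"

definition connected_graph :: "'a ugraph \<Rightarrow> bool" where
  "connected_graph G \<longleftrightarrow>
     verts G \<noteq> {} \<and> (\<forall>u\<in>verts G. \<forall>v\<in>verts G. (adjacent G)\<^sup>*\<^sup>* u v)"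

definition vertex_connected :: "nat \<Rightarrow> 'a ugraph \<Rightarrow> bool" where
  "vertex_connected k G \<longleftrightarrow> card (verts G) > k \<and>
     (\<forall>X\<subseteq>verts G. card X < k \<longrightarrow> connected_graph (induced_subgraph G (verts G - X)))"

definition edge_colorable :: "nat \<Rightarrow> 'a ugraph \<Rightarrow> bool" where
  "edge_colorable k G \<longleftrightarrow> (\<exists>c :: 'a set \<Rightarrow> nat.
     (\<forall>e\<in>edges G. c e < k) \<and>
     (\<forall>e\<in>edges G. \<forall>e'\<in>edges G. e \<noteq> e' \<and> e \<inter> e' \<noteq> {} \<longrightarrow> c e \<noteq> c e'))"

definition snark :: "'a ugraph \<Rightarrow> bool" where
  "snark G \<longleftrightarrow> simple_graph G \<and> cubic G \<and> vertex_connected 2 G \<and> \<not> edge_colorable 3 G"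

definition is_cycle :: "'a ugraph \<Rightarrow> 'a list \<Rightarrow> bool" where
  "is_cycle G vs \<longleftrightarrow> length vs \<ge> 3 \<and> distinct vs \<and> set vs \<subseteq> verts G \<and>
     (\<forall>i<length vs. adjacent G (vs ! i) (vs ! (Suc i mod length vs)))"

definition contains_cycle :: "'a ugraph \<Rightarrow> bool" where
  "contains_cycle G \<longleftrightarrow> (\<exists>vs. is_cycle G vs)"

definition edge_boundary :: "'a ugraph \<Rightarrow> 'a set \<Rightarrow> 'a set set" where
  "edge_boundary G X = {e \<in> edges G. card (e \<inter> X) = 1}"

definition cyclically_edge_connected :: "nat \<Rightarrow> 'a ugraph \<Rightarrow> bool" where
  "cyclically_edge_connected k G \<longleftrightarrow> \<not> (\<exists>X\<subseteq>verts G.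
     contains_cycle (induced_subgraph G X) \<and>
     contains_cycle (induced_subgraph G (verts G - X)) \<and>
     card (edge_boundary G X) < k)"

text \<open>Both minima below are attained, since deleting every edge is always admissible.\<close>

definition resistance :: "'a ugraph \<Rightarrow> nat" where
  "resistance G =
     (LEAST k. \<exists>F\<subseteq>edges G. card F = k \<and> edge_colorable 3 (delete_edges G F))"

definition is_flow :: "'a ugraph \<Rightarrow> ('a set \<Rightarrow> bit \<times> bit) \<Rightarrow> bool" where
  "is_flow G f \<longleftrightarrow> (\<forall>v\<in>verts G. (\<Sum>e\<in>incident_edges G v. f e) = 0)"

definition nowhere_zero :: "'a ugraph \<Rightarrow> ('a set \<Rightarrow> bit \<times> bit) \<Rightarrow> bool" where
  "nowhere_zero G f \<longleftrightarrow> (\<forall>e\<in>edges G. f e \<noteq> 0)"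

definition flow_resistance :: "'a ugraph \<Rightarrow> nat" where
  "flow_resistance G = (LEAST k. \<exists>F\<subseteq>edges G. card F = k \<and>
     (\<exists>f. is_flow (delete_edges G F) f \<and> nowhere_zero (delete_edges G F) f))"

end

theory Submission
  imports Defs
begin

text \<open>
  Deleting two non-adjacent vertices of the Petersen graph leaves a gadget \<open>M\<close> with two
  3-edge connectors; in a nowhere-zero flow the sum over each connector is nonzero, since otherwise
  the Petersen graph would have a nowhere-zero flow. Deleting a path on three vertices leaves a
  gadget \<open>N\<close> with two 2-edge connectors and one residual edge; in a nowhere-zero flow
  one of the two connectors has sum zero.

  A layer has 40 vertices: \<open>M - M - M\<close> joined along three strands, and \<open>N - N\<close> joined along two,
  where the residual edge of each \<open>N\<close> ends in a vertex subdividing one of the three strands. The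
  graph is a chain of \<open>n\<close> layers, consecutive ones being joined by the 3 + 2 strands. At each
  end three of the five strands meet in one new vertex and the other two are joined.
  In a flow the five strands at each interface sum to zero. If a layer had no zero edge, then the
  sum over its three \<open>M\<close>-strands on the left would be some \<open>a \<noteq> 0\<close>, hence so would the sum over the
  two \<open>N\<close>-strands; so the right connector of the first \<open>N\<close> has sum zero, its residual edge has value
  \<open>a\<close>, and the three strands entering the second \<open>M\<close> have sum \<open>a + a = 0\<close>, a contradiction. So every
  flow has a zero in each layer. On the other hand, each gadget is colorable when the strand sum is
  not required to vanish, so two deleted edges, one at each end, suffice for a 3-edge-coloring.

  Cyclic 5-edge-connectivity follows from \<open>|\<partial> X| \<ge> 5\<close> for all vertex sets \<open>X\<close> with at least three
  vertices inside and outside. This is a dynamic program along the chain, whose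
  set of states is already stable after one layer.
\<close>

subsection \<open>Flows, colorings and connectivity of cubic graphs\<close>

lemma bit_pair_add_self [simp]: "a + a = (0 :: bit \<times> bit)"
  by (cases a) (simp add: zero_prod_def)

lemma bit_pair_add_eq_0_iff: "a + b = 0 \<longleftrightarrow> a = (b :: bit \<times> bit)"
proof -
  have "a + b + b = a" by (simp add: add.assoc)
  then show ?thesis by (metis add_0 bit_pair_add_self)
qed

lemma simple_graph_finite_edges:
  assumes "simple_graph G"
  shows "finite (edges G)"
proof (rule finite_subset)
  show "edges G \<subseteq> Pow (verts G)"
    using assms by (auto simp: simple_graph_def)
qed (use assms in \<open>auto simp: simple_graph_def\<close>)

lemma simple_graph_edgeE:
  assumes "simple_graph G" "e \<in> edges G"
  obtains u v where "e = {u, v}" "u \<noteq> v" "u \<in> verts G" "v \<in> verts G"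
proof -
  have "card e = 2" "e \<subseteq> verts G"
    using assms by (auto simp: simple_graph_def)
  moreover from this obtain u v where "e = {u, v}" "u \<noteq> v"
    by (auto simp: card_2_iff)
  ultimately show ?thesis using that by auto
qed

text \<open>Every edge is counted at both of its ends, and \<open>a + a = 0\<close> in this
  group.\<close>

lemma sum_incident_edges_eq_0:
  fixes f :: "'a set \<Rightarrow> bit \<times> bit"
  assumes "simple_graph G"
  shows "(\<Sum>v\<in>verts G. \<Sum>e\<in>incident_edges G v. f e) = 0"
proof -
  have fin: "finite (verts G)" "finite (edges G)"
    using assms simple_graph_finite_edges by (auto simp: simple_graph_def)
  have "(\<Sum>v\<in>verts G. \<Sum>e\<in>incident_edges G v. f e)
      = (\<Sum>v\<in>verts G. \<Sum>e | e \<in> edges G \<and> v \<in> e. f e)"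
    by (simp add: incident_edges_def)
  also have "\<dots> = (\<Sum>e\<in>edges G. \<Sum>v | v \<in> verts G \<and> v \<in> e. f e)"
    using fin by (rule sum.swap_restrict)
  also have "\<dots> = (\<Sum>e\<in>edges G. 0)"
  proof (rule sum.cong)
    fix e assume "e \<in> edges G"
    then have e: "e \<subseteq> verts G" "card e = 2"
      using assms by (auto simp: simple_graph_def)
    then have "{v \<in> verts G. v \<in> e} = e" by auto
    moreover obtain u v where "e = {u, v}" "u \<noteq> v"
      using e by (auto simp: card_2_iff)
    ultimately show "(\<Sum>v | v \<in> verts G \<and> v \<in> e. f e) = 0"
      by simp
  qed simp
  finally show ?thesis by simp
qed

text \<open>The three colors become the three nonzero group elements, whose sum is zero; so a proper
  3-edge-coloring of a cubic graph is a nowhere-zero flow.\<close>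

definition color_vec :: "nat \<Rightarrow> bit \<times> bit" where
  "color_vec c = (if c = 0 then (1, 0) else if c = 1 then (0, 1) else (1, 1))"

lemma color_vec_neq_0: "color_vec c \<noteq> 0"
  by (simp add: color_vec_def zero_prod_def)

lemma color_vec_add_neq_0:
  "c < 3 \<Longrightarrow> d < 3 \<Longrightarrow> c \<noteq> d \<Longrightarrow> color_vec c + color_vec d \<noteq> 0"
  by (auto simp: color_vec_def zero_prod_def less_Suc_eq numeral_3_eq_3)

lemma color_vec_sum_eq_0:
  assumes "a < 3" "b < 3" "c < 3" "a \<noteq> b" "a \<noteq> c" "b \<noteq> c"
  shows "color_vec a + (color_vec b + color_vec c) = 0"
  using assms by (auto simp: color_vec_def zero_prod_def less_Suc_eq numeral_3_eq_3)

lemma cubic_incident_edges: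
  assumes "cubic G" "v \<in> verts G" "e \<in> incident_edges G v"
  obtains e1 e2 where "incident_edges G v = {e, e1, e2}" "e \<noteq> e1" "e \<noteq> e2" "e1 \<noteq> e2"
proof -
  have "card (incident_edges G v) = 3"
    using assms by (simp add: cubic_def)
  then have "card (incident_edges G v - {e}) = 2"
    using assms(3) by (simp add: card_Diff_singleton)
  then obtain a b where "incident_edges G v - {e} = {a, b}" "a \<noteq> b"
    by (auto simp: card_2_iff)
  with assms(3) show ?thesis
    by (intro that[of a b]) auto
qed

text \<open>Summing over all vertices shows that the two ends of a single uncolored edge miss the same
  color, so the coloring extends.\<close>

lemma nowhere_zero_flow_of_coloring:
  assumes simp: "simple_graph G" and "cubic G" and F: "F \<subseteq> edges G" "card F \<le> 1"
    and col: "edge_colorable 3 (delete_edges G F)"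
  shows "\<exists>f. is_flow G f \<and> nowhere_zero G f"
proof -
  obtain c :: "'a set \<Rightarrow> nat" where c: "\<forall>e\<in>edges G - F. c e < 3"
      "\<forall>e\<in>edges G - F. \<forall>e'\<in>edges G - F. e \<noteq> e' \<and> e \<inter> e' \<noteq> {} \<longrightarrow> c e \<noteq> c e'"
    using col by (auto simp: edge_colorable_def delete_edges_def)
  have c3: "c e < 3" if "e \<in> edges G - F" for e
    using c(1) that by blast
  have proper: "c e \<noteq> c e'"
    if "e \<in> edges G - F" "e' \<in> edges G - F" "e \<noteq> e'" "e \<inter> e' \<noteq> {}" for e e'
    using c(2) that by blast
  have full: "(\<Sum>e\<in>incident_edges G v. color_vec (c e)) = 0"
    if v: "v \<in> verts G" and vF: "incident_edges G v \<inter> F = {}" for v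
  proof -
    have "card (incident_edges G v) = 3"
      using v \<open>cubic G\<close> by (simp add: cubic_def)
    then obtain a b d where abd: "incident_edges G v = {a, b, d}" "a \<noteq> b" "a \<noteq> d" "b \<noteq> d"
      by (auto simp: card_3_iff)
    have "{a, b, d} \<subseteq> incident_edges G v" using abd by simp
    then have in_EF: "a \<in> edges G - F" "b \<in> edges G - F" "d \<in> edges G - F"
      and "v \<in> a" "v \<in> b" "v \<in> d"
      using vF by (auto simp: incident_edges_def)
    then have "a \<inter> b \<noteq> {}" "a \<inter> d \<noteq> {}" "b \<inter> d \<noteq> {}" by blast+
    then have "c a \<noteq> c b" "c a \<noteq> c d" "c b \<noteq> c d" "c a < 3" "c b < 3" "c d < 3"
      using in_EF abd(2-4) by (simp_all add: c3 proper)
    with abd show ?thesis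
      by (simp add: color_vec_sum_eq_0)
  qed
  have finF: "finite F"
    using F(1) simple_graph_finite_edges[OF simp] by (rule finite_subset)
  show ?thesis
  proof (cases "F = {}")
    case True
    then have "is_flow G (\<lambda>e. color_vec (c e)) \<and> nowhere_zero G (\<lambda>e. color_vec (c e))"
      by (auto simp: is_flow_def nowhere_zero_def full color_vec_neq_0)
    then show ?thesis by blast
  next
    case False
    then have "card F = 1" using F(2) finF by (simp add: le_Suc_eq)
    then obtain e where e: "F = {e}" by (auto simp: card_1_singleton_iff)
    then have eG: "e \<in> edges G" using F by simp
    obtain u w where uw: "e = {u, w}" "u \<noteq> w" "u \<in> verts G" "w \<in> verts G"
      by (rule simple_graph_edgeE[OF simp eG])
    have eu: "e \<in> incident_edges G u" using eG uw by (simp add: incident_edges_def)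
    obtain a b where ab: "incident_edges G u = {e, a, b}" "e \<noteq> a" "e \<noteq> b" "a \<noteq> b"
      by (rule cubic_incident_edges[OF \<open>cubic G\<close> uw(3) eu])
    have "{e, a, b} \<subseteq> incident_edges G u" using ab by simp
    then have ab': "a \<in> edges G - F" "b \<in> edges G - F" "u \<in> a" "u \<in> b"
      using e ab(2,3) by (auto simp: incident_edges_def)
    then have "a \<inter> b \<noteq> {}" by blast
    \<comment> \<open>Conservation at \<open>u\<close> forces this value; it is nonzero because
      \<open>a\<close> and \<open>b\<close> have different colors.\<close>
    define f where "f = (\<lambda>e. color_vec (c e))(e := color_vec (c a) + color_vec (c b))"
    have f_other: "(\<Sum>e\<in>incident_edges G v. f e) = 0" if "v \<in> verts G" "v \<noteq> w" for v
    proof (cases "v = u")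
      case True
      with ab show ?thesis by (simp add: f_def add.assoc)
    next
      case False
      then have "e \<notin> incident_edges G v"
        using that uw by (auto simp: incident_edges_def)
      then have "(\<Sum>e\<in>incident_edges G v. f e) = (\<Sum>e\<in>incident_edges G v. color_vec (c e))"
        by (intro sum.cong) (auto simp: f_def)
      with full[OF that(1)] \<open>e \<notin> _\<close> e show ?thesis by simp
    qed
    \<comment> \<open>The total over all vertices vanishes and reduces to the sum at
      \<open>w\<close>, so conservation also holds there.\<close>
    have "(\<Sum>v\<in>verts G. \<Sum>e\<in>incident_edges G v. f e) = (\<Sum>e\<in>incident_edges G w. f e)"
      using simp uw f_other by (subst sum.remove[of _ w]) (auto simp: simple_graph_def)
    then have "(\<Sum>e\<in>incident_edges G w. f e) = 0"
      by (simp add: sum_incident_edges_eq_0[OF simp])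
    with f_other have "is_flow G f" by (auto simp: is_flow_def)
    moreover have "nowhere_zero G f"
      using color_vec_add_neq_0[OF c3 c3 proper] ab(4) ab' \<open>a \<inter> b \<noteq> {}\<close>
      by (simp add: nowhere_zero_def f_def color_vec_neq_0)
    ultimately show ?thesis by blast
  qed
qed

text \<open>Deleting the zero edges of a flow makes it nowhere-zero, and a flow after a deletion
  extends by zero to the deleted edges. So the flow resistance is the least number of zeros of a
  flow.\<close>

lemma flow_resistance_eqI:
  assumes fin: "finite (edges G)"
    and lower: "\<And>f. is_flow G f \<Longrightarrow> n \<le> card {e \<in> edges G. f e = 0}"
    and upper: "is_flow G f" "card {e \<in> edges G. f e = 0} \<le> n"
  shows "flow_resistance G = n"
  unfolding flow_resistance_def
proof (rule Least_equality)
  have inc: "incident_edges (delete_edges G F) v = incident_edges G v - F" for F v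
    by (auto simp: incident_edges_def delete_edges_def)
  have fin_inc: "finite (incident_edges G v)" for v
    using fin by (simp add: incident_edges_def)
  define Z where "Z = {e \<in> edges G. f e = 0}"
  have "(\<Sum>e\<in>incident_edges G v - Z. f e) = (\<Sum>e\<in>incident_edges G v. f e)" for v
    using fin_inc by (intro sum.mono_neutral_left) (auto simp: Z_def incident_edges_def)
  then have "is_flow (delete_edges G Z) f"
    using upper(1) by (auto simp: is_flow_def inc) (simp add: delete_edges_def)
  moreover have "nowhere_zero (delete_edges G Z) f"
    by (auto simp: nowhere_zero_def delete_edges_def Z_def)
  moreover have "card Z = n"
    using lower[OF upper(1)] upper(2) by (simp add: Z_def)
  moreover have "Z \<subseteq> edges G" by (auto simp: Z_def)
  ultimately show "\<exists>F\<subseteq>edges G. card F = n \<and>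
      (\<exists>f. is_flow (delete_edges G F) f \<and> nowhere_zero (delete_edges G F) f)"
    by blast
  fix k
  assume "\<exists>F\<subseteq>edges G. card F = k \<and>
      (\<exists>f. is_flow (delete_edges G F) f \<and> nowhere_zero (delete_edges G F) f)"
  then obtain F g where F: "F \<subseteq> edges G" "card F = k"
    and g: "is_flow (delete_edges G F) g" "nowhere_zero (delete_edges G F) g" by blast
  define g0 where "g0 e = (if e \<in> F then 0 else g e)" for e
  have "(\<Sum>e\<in>incident_edges G v. g0 e) = (\<Sum>e\<in>incident_edges G v - F. g e)" for v
    using fin_inc by (intro sum.mono_neutral_cong_right) (auto simp: g0_def)
  then have "is_flow G g0"
    using g(1) by (auto simp: is_flow_def inc) (simp add: delete_edges_def)
  moreover have "{e \<in> edges G. g0 e = 0} \<subseteq> F"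
    using g(2) by (auto simp: nowhere_zero_def g0_def delete_edges_def)
  then have "card {e \<in> edges G. g0 e = 0} \<le> k"
    using F fin by (metis card_mono finite_subset)
  ultimately show "n \<le> k" using lower order_trans by blast
qed

text \<open>If deleting at most one edge sufficed, \<open>nowhere_zero_flow_of_coloring\<close>
  would give a nowhere-zero flow.\<close>

lemma resistance_eq_2I:
  assumes "simple_graph G" "cubic G"
    and no_flow: "\<And>f. is_flow G f \<Longrightarrow> \<not> nowhere_zero G f"
    and F: "F \<subseteq> edges G" "card F \<le> 2" "edge_colorable 3 (delete_edges G F)"
  shows "resistance G = 2"
proof -
  have lower: "2 \<le> card F'" if "F' \<subseteq> edges G" "edge_colorable 3 (delete_edges G F')" for F'
    using nowhere_zero_flow_of_coloring[OF assms(1,2) that(1) _ that(2)] no_flow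
    by (cases "card F' \<le> 1") auto
  show ?thesis
    unfolding resistance_def
  proof (rule Least_equality)
    show "\<exists>F\<subseteq>edges G. card F = 2 \<and> edge_colorable 3 (delete_edges G F)"
      using F lower[OF F(1,3)] by (intro exI[of _ F]) simp
  qed (use lower in blast)
qed

lemma not_edge_colorableI:
  assumes "simple_graph G" "cubic G" "\<And>f. is_flow G f \<Longrightarrow> \<not> nowhere_zero G f"
  shows "\<not> edge_colorable 3 G"
proof
  assume "edge_colorable 3 G"
  then have "edge_colorable 3 (delete_edges G {})"
    by (simp add: delete_edges_def edge_colorable_def)
  from nowhere_zero_flow_of_coloring[OF assms(1,2) _ _ this] assms(3) show False by auto
qed

section \<open>From edge boundaries to connectivity\<close>

lemma cyclically_5_edge_connectedI:
  assumes fin: "finite (verts G)"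
    and iso: "\<And>X. X \<subseteq> verts G \<Longrightarrow> 3 \<le> card X \<Longrightarrow> 3 \<le> card (verts G - X) \<Longrightarrow>
      5 \<le> card (edge_boundary G X)"
  shows "cyclically_edge_connected 5 G"
proof -
  have card3: "3 \<le> card X" if X: "contains_cycle (induced_subgraph G X)" "X \<subseteq> verts G" for X
  proof -
    obtain vs where "is_cycle (induced_subgraph G X) vs"
      using X(1) by (auto simp: contains_cycle_def)
    then have vs: "3 \<le> length vs" "distinct vs" "set vs \<subseteq> X"
      by (auto simp: is_cycle_def induced_subgraph_def)
    then have "length vs = card (set vs)" by (simp add: distinct_card)
    also have "\<dots> \<le> card X"
      using vs(3) X(2) fin by (meson card_mono finite_subset)
    finally show ?thesis using vs(1) by simp
  qed
  show ?thesis
    unfolding cyclically_edge_connected_def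
  proof (intro notI, elim exE conjE)
    fix X assume X: "X \<subseteq> verts G" "contains_cycle (induced_subgraph G X)"
      "contains_cycle (induced_subgraph G (verts G - X))" "card (edge_boundary G X) < 5"
    have "3 \<le> card X" "3 \<le> card (verts G - X)"
      using card3[OF X(2,1)] card3[OF X(3)] by auto
    with iso[OF X(1)] X(4) show False by simp
  qed
qed

text \<open>If deleting a vertex \<open>w\<close> separated \<open>C\<close> from \<open>D\<close>,
  all boundary edges of both would end in \<open>w\<close>. The two boundaries are disjoint with at
  least two edges each, but \<open>w\<close> has degree 3.\<close>

lemma vertex_connected_2I:
  assumes simp: "simple_graph G" and "cubic G" and "2 < card (verts G)"
    and iso: "\<And>X. X \<subseteq> verts G \<Longrightarrow> X \<noteq> {} \<Longrightarrow> X \<noteq> verts G \<Longrightarrow> 2 \<le> card (edge_boundary G X)"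
  shows "vertex_connected 2 G"
proof -
  have "connected_graph (induced_subgraph G (verts G - X))"
    if X: "X \<subseteq> verts G" "card X < 2" for X
  proof -
    define K where "K = induced_subgraph G (verts G - X)"
    have vK: "verts K = verts G - X" and eK: "edges K = {e \<in> edges G. e \<subseteq> verts G - X}"
      by (auto simp: K_def induced_subgraph_def)
    have fin: "finite (verts G)" "finite (edges G)"
      using simp simple_graph_finite_edges by (auto simp: simple_graph_def)
    have finX: "finite X" using X fin by (meson finite_subset)
    have "card (verts K) > 0"
      using X assms(3) finX by (simp add: vK card_Diff_subset)
    then have ne: "verts K \<noteq> {}" by auto
    have "(adjacent K)\<^sup>*\<^sup>* u v" if u: "u \<in> verts K" and v: "v \<in> verts K" for u v
    proof (rule ccontr)
      assume not: "\<not> (adjacent K)\<^sup>*\<^sup>* u v"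
      define C where "C = {w \<in> verts K. (adjacent K)\<^sup>*\<^sup>* u w}"
      define D where "D = verts K - C"
      have CD: "C \<subseteq> verts G" "C \<noteq> {}" "D \<subseteq> verts G" "D \<noteq> {}" "C \<inter> D = {}" "u \<in> C" "v \<in> D"
        using u v not by (auto simp: C_def D_def vK)
      then have CD': "C \<noteq> verts G" "D \<noteq> verts G" by auto
      have no_edge: "{c, d} \<notin> edges G" if "c \<in> C" "d \<in> D" for c d
      proof
        assume "{c, d} \<in> edges G"
        with that have "adjacent K c d"
          by (auto simp: adjacent_def eK C_def D_def vK)
        with that have "d \<in> C" by (auto simp: C_def D_def intro: rtranclp.rtrancl_into_rtrancl)
        with that show False by (simp add: D_def)
      qed
      have bd: "\<exists>x\<in>X. \<exists>y\<in>Y. e = {x, y}"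
        if "e \<in> edge_boundary G Y" "Y = C \<or> Y = D" for e Y
      proof -
        have "e \<in> edges G" "card (e \<inter> Y) = 1" using that by (auto simp: edge_boundary_def)
        then obtain y where y: "e \<inter> Y = {y}" by (auto simp: card_1_singleton_iff)
        obtain a b where ab: "e = {a, b}" "a \<noteq> b" "a \<in> verts G" "b \<in> verts G"
          by (rule simple_graph_edgeE[OF simp \<open>e \<in> edges G\<close>])
        define x where "x = (if a = y then b else a)"
        have x: "e = {x, y}" "x \<in> verts G" "x \<notin> Y" "y \<in> Y"
          using y ab unfolding x_def by (auto simp: Int_insert_left split: if_splits)
        have "x \<in> X"
        proof (rule ccontr)
          assume "x \<notin> X"
          then have "x \<in> C \<or> x \<in> D" using x by (auto simp: D_def vK)
          then show False
            using x(1,3,4) that(2) \<open>e \<in> edges G\<close> no_edge[of x y] no_edge[of y x]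
            by (auto simp: insert_commute)
        qed
        with x show ?thesis by blast
      qed
      have "edge_boundary G C \<noteq> {}"
        using iso[OF CD(1,2) CD'(1)] by auto
      then have "X \<noteq> {}" using bd[of _ C] by blast
      then have "card X = 1" using X(2) finX by (simp add: less_2_cases_iff)
      then obtain w where Xw: "X = {w}" by (auto simp: card_1_singleton_iff)
      then have w: "w \<in> X" by simp
      have wG: "w \<in> verts G" using w X by auto
      have sub: "edge_boundary G C \<union> edge_boundary G D \<subseteq> incident_edges G w"
      proof
        fix e assume e: "e \<in> edge_boundary G C \<union> edge_boundary G D"
        then have "w \<in> e" using bd Xw by blast
        with e show "e \<in> incident_edges G w" by (auto simp: incident_edges_def edge_boundary_def)
      qed
      have "edge_boundary G C \<inter> edge_boundary G D = {}"
      proof -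
        { fix e assume "e \<in> edge_boundary G C" "e \<in> edge_boundary G D"
          then obtain c d where "c \<in> C" "d \<in> D" "e = {w, c}" "e = {w, d}"
            using bd[of e C] bd[of e D] Xw by blast
          then have False using CD(5) by (auto simp: doubleton_eq_iff) }
        then show ?thesis by blast
      qed
      then have "card (edge_boundary G C) + card (edge_boundary G D)
          = card (edge_boundary G C \<union> edge_boundary G D)"
        using fin by (intro card_Un_disjoint[symmetric]) (auto simp: edge_boundary_def)
      also have "\<dots> \<le> card (incident_edges G w)"
        using sub fin by (intro card_mono) (auto simp: incident_edges_def)
      also have "\<dots> = 3" using \<open>cubic G\<close> wG by (simp add: cubic_def)
      finally show False
        using iso[OF CD(1,2) CD'(1)] iso[OF CD(3,4) CD'(2)] by simp
    qed
    with ne show ?thesis by (simp add: connected_graph_def K_def)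
  qed
  with assms(3) show ?thesis by (simp add: vertex_connected_def)
qed

subsection \<open>Graphs given by neighbor lists\<close>

definition nbr_graph :: "nat set \<Rightarrow> (nat \<Rightarrow> nat list) \<Rightarrow> nat ugraph" where
  "nbr_graph V N = \<lparr>verts = V, edges = {{v, u} | v u. v \<in> V \<and> u \<in> set (N v)}\<rparr>"

locale cubic_nbrs =
  fixes V :: "nat set" and N :: "nat \<Rightarrow> nat list"
  assumes fin: "finite V"
    and nbr_in: "v \<in> V \<Longrightarrow> u \<in> set (N v) \<Longrightarrow> u \<in> V"
    and nbr_sym: "v \<in> V \<Longrightarrow> u \<in> set (N v) \<Longrightarrow> v \<in> set (N u)"
    and nbr_irrefl: "v \<in> V \<Longrightarrow> v \<notin> set (N v)"
    and nbr_length: "v \<in> V \<Longrightarrow> length (N v) = 3"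
    and nbr_distinct: "v \<in> V \<Longrightarrow> distinct (N v)"
begin

abbreviation "G \<equiv> nbr_graph V N"

lemma verts_G [simp]: "verts G = V"
  by (simp add: nbr_graph_def)

lemma edges_G: "edges G = {{v, u} | v u. v \<in> V \<and> u \<in> set (N v)}"
  by (simp add: nbr_graph_def)

lemma simple: "simple_graph G"
proof -
  have "e \<subseteq> V \<and> card e = 2" if eG: "e \<in> edges G" for e
  proof -
    obtain v u where e: "e = {v, u}" "v \<in> V" "u \<in> set (N v)"
      using eG by (auto simp: edges_G)
    with nbr_irrefl[of v] have "u \<noteq> v" by auto
    with e nbr_in show ?thesis by auto
  qed
  with fin show ?thesis by (simp add: simple_graph_def)
qed

lemma incident_edges_G:
  assumes "v \<in> V"
  shows "incident_edges G v = (\<lambda>u. {v, u}) ` set (N v)"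
  using assms nbr_sym by (auto simp: incident_edges_def edges_G)

lemma inj_on_nbr: "inj_on (\<lambda>u. {v, u}) A"
  by (auto simp: inj_on_def doubleton_eq_iff)

lemma cubic: "cubic G"
  by (simp add: cubic_def incident_edges_G card_image[OF inj_on_nbr] distinct_card
      nbr_distinct nbr_length)

lemma sum_incident_edges:
  assumes "v \<in> V"
  shows "(\<Sum>e\<in>incident_edges G v. f e) = (\<Sum>u\<leftarrow>N v. f {v, u})"
  by (simp add: incident_edges_G[OF assms] sum.reindex[OF inj_on_nbr]
      sum_list_distinct_conv_sum_set nbr_distinct[OF assms])

text \<open>Each boundary edge is counted once, at its larger end. This suits the dynamic program
  below, which adds the vertices in increasing order.\<close>

lemma card_edge_boundary:
  "card (edge_boundary G X)
    = (\<Sum>v\<in>V. \<Sum>u\<leftarrow>N v. of_bool (u < v \<and> (u \<in> X) \<noteq> (v \<in> X)))"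
proof -
  define B where "B v = {u \<in> set (N v). u < v \<and> (u \<in> X) \<noteq> (v \<in> X)}" for v
  have 1: "edge_boundary G X = (\<Union>v\<in>V. (\<lambda>u. {v, u}) ` B v)" (is "_ = ?R")
  proof (intro equalityI subsetI)
    fix e assume "e \<in> edge_boundary G X"
    then obtain v u where e: "e = {v, u}" "v \<in> V" "u \<in> set (N v)" "card (e \<inter> X) = 1"
      by (auto simp: edge_boundary_def edges_G)
    have "u \<noteq> v" using e nbr_irrefl by auto
    have neq: "(u \<in> X) \<noteq> (v \<in> X)"
      using e \<open>u \<noteq> v\<close> by (auto simp: Int_insert_left split: if_splits)
    show "e \<in> ?R"
    proof (cases "u < v")
      case True
      with e neq show ?thesis by (auto simp: B_def)
    next
      case False
      then have "v < u" using \<open>u \<noteq> v\<close> by simp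
      moreover have "u \<in> V" "v \<in> set (N u)" using e nbr_in[of v u] nbr_sym[of v u] by simp_all
      ultimately have "u \<in> V" "v \<in> B u" using neq by (auto simp: B_def)
      then show ?thesis unfolding e(1) by (auto simp: insert_commute)
    qed
  next
    fix e assume "e \<in> ?R"
    then show "e \<in> edge_boundary G X"
      by (auto simp: B_def edge_boundary_def edges_G Int_insert_left)
  qed
  have 2: "card ?R = (\<Sum>v\<in>V. card ((\<lambda>u. {v, u}) ` B v))"
    using fin by (intro card_UN_disjoint) (auto simp: B_def doubleton_eq_iff)
  have 3: "card ((\<lambda>u. {v, u}) ` B v)
      = (\<Sum>u\<leftarrow>N v. of_bool (u < v \<and> (u \<in> X) \<noteq> (v \<in> X)))" if "v \<in> V" for v
  proof -
    have "card ((\<lambda>u. {v, u}) ` B v) = (\<Sum>u\<in>B v. 1)"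
      by (simp add: card_image[OF inj_on_nbr])
    also have "\<dots> = (\<Sum>u\<in>set (N v). of_bool (u < v \<and> (u \<in> X) \<noteq> (v \<in> X)))"
      by (intro sum.mono_neutral_cong_left) (auto simp: B_def)
    also have "\<dots> = (\<Sum>u\<leftarrow>N v. of_bool (u < v \<and> (u \<in> X) \<noteq> (v \<in> X)))"
      by (simp add: sum_list_distinct_conv_sum_set nbr_distinct[OF that])
    finally show ?thesis .
  qed
  show ?thesis
    unfolding 1 2 by (rule sum.cong) (simp_all only: 3)
qed

end

subsection \<open>The chain of layers\<close>

text \<open>
  An edge at a vertex of a layer leads to the vertex \<open>k\<close> of the same layer (\<open>I k\<close>), or it is the
  strand \<open>k\<close> on the left (\<open>L k\<close>) or on the right (\<open>R k\<close>) side of the layer. Strands 0, 1, 2 belong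
  to the gadgets \<open>M\<close>, which occupy the vertices 0--7, 16--23 and 32--39. Strands 3, 4 belong to the
  gadgets \<open>N\<close> on 8--14 and 24--30. The vertices 15 and 31 carry the residual edges.
  The order of the vertices is chosen to keep the frontier of the dynamic program small.
\<close>

datatype port = I nat | L nat | R nat

text \<open>Entry \<open>k\<close> is the vertex of a layer that carries strand \<open>k\<close>, on
  the left for \<open>lterm\<close> and on the right for \<open>rterm\<close>.\<close>

definition lterm :: "nat list" where "lterm = [0, 1, 2, 8, 9]"

definition rterm :: "nat list" where "rterm = [39, 35, 33, 30, 27]"

definition port_table :: "port list list" where
  "port_table = [
   [L 0, I 6, I 7], [L 1, I 5, I 15], [L 2, I 3, I 4], [I 2, I 6, I 18],
   [I 2, I 5, I 7], [I 1, I 4, I 6], [I 0, I 3, I 5], [I 0, I 4, I 16],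
   [L 3, I 13, I 14], [L 4, I 10, I 11], [I 9, I 12, I 14], [I 9, I 13, I 25],
   [I 10, I 13, I 15], [I 8, I 11, I 12], [I 8, I 10, I 24], [I 1, I 12, I 17],
   [I 7, I 22, I 23], [I 15, I 21, I 31], [I 3, I 19, I 20], [I 18, I 22, I 34],
   [I 18, I 21, I 23], [I 17, I 20, I 22], [I 16, I 19, I 21], [I 16, I 20, I 32],
   [I 14, I 29, I 30], [I 11, I 26, I 27], [I 25, I 28, I 30], [I 25, I 29, R 4],
   [I 26, I 29, I 31], [I 24, I 27, I 28], [I 24, I 26, R 3], [I 17, I 28, I 33],
   [I 23, I 38, I 39], [I 31, I 37, R 2], [I 19, I 35, I 36], [I 34, I 38, R 1],
   [I 34, I 37, I 39], [I 33, I 36, I 38], [I 32, I 35, I 37], [I 32, I 36, R 0]]"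

definition ports :: "nat \<Rightarrow> port list" where
  "ports j = port_table ! j"

text \<open>The end vertices are 0 and \<open>40 * n + 1\<close>; at both ends they take the strands 1, 2, 3, while the
  strands 0 and 4 are joined to each other.\<close>

definition vtx :: "nat \<Rightarrow> nat \<Rightarrow> nat" where
  "vtx i j = Suc (40 * i + j)"

fun target :: "nat \<Rightarrow> nat \<Rightarrow> port \<Rightarrow> nat" where
  "target n i (I k) = vtx i k"
| "target n i (L k) =
    (if i = 0 then (if k = 0 then vtx 0 (lterm ! 4) else if k = 4 then vtx 0 (lterm ! 0) else 0)
     else vtx (i - 1) (rterm ! k))"
| "target n i (R k) =
    (if Suc i = n
     then (if k = 0 then vtx i (rterm ! 4) else if k = 4 then vtx i (rterm ! 0) else Suc (40 * n))
     else vtx (Suc i) (lterm ! k))"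

definition nbrs :: "nat \<Rightarrow> nat \<Rightarrow> nat list" where
  "nbrs n v =
    (if v = 0 then map (\<lambda>k. vtx 0 (lterm ! k)) [1, 2, 3]
     else if v = Suc (40 * n) then map (\<lambda>k. vtx (n - 1) (rterm ! k)) [1, 2, 3]
     else map (target n ((v - 1) div 40)) (ports ((v - 1) mod 40)))"

definition chain :: "nat \<Rightarrow> nat ugraph" where
  "chain n = nbr_graph {..Suc (40 * n)} (nbrs n)"

text \<open>These checks make the chain simple and cubic. Since at most one port of a vertex leaves
  the layer, no two ports lead to the same outer vertex. The conditions with \<open>4 - k\<close>
  ensure that joining strands 0 and 4 at an end creates no parallel edge.\<close>

definition row_ok :: "nat \<Rightarrow> bool" where
  "row_ok j \<longleftrightarrow> length (ports j) = 3 \<and> distinct (ports j) \<and>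
    length (filter (\<lambda>p. case p of I k \<Rightarrow> False | _ \<Rightarrow> True) (ports j)) \<le> 1 \<and>
    list_all (\<lambda>p. case p of
       I k \<Rightarrow> k < 40 \<and> k \<noteq> j \<and> I j \<in> set (ports k)
     | L k \<Rightarrow> k < 5 \<and> j = lterm ! k \<and> I (lterm ! (4 - k)) \<notin> set (ports j)
     | R k \<Rightarrow> k < 5 \<and> j = rterm ! k \<and> I (rterm ! (4 - k)) \<notin> set (ports j)) (ports j)"

lemma all_rows_ok: "list_all row_ok [0..<40]"
  by code_simp

lemma all_terms_ok:
  "list_all (\<lambda>k. lterm ! k < 40 \<and> L k \<in> set (ports (lterm ! k)) \<and>
     rterm ! k < 40 \<and> R k \<in> set (ports (rterm ! k))) [0..<5]"
  by code_simp

lemma row_ok: "j < 40 \<Longrightarrow> row_ok j"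
  using all_rows_ok by (simp add: list_all_iff)

lemma term_ok:
  assumes "k < 5"
  shows "lterm ! k < 40" "L k \<in> set (ports (lterm ! k))"
    "rterm ! k < 40" "R k \<in> set (ports (rterm ! k))"
  using all_terms_ok assms by (simp_all add: list_all_iff)

lemma ports_I:
  assumes "j < 40" "I k \<in> set (ports j)"
  shows "k < 40" "k \<noteq> j" "I j \<in> set (ports k)"
  using row_ok[OF assms(1)] assms(2) by (auto simp: row_ok_def list_all_iff)

lemma ports_L:
  assumes "j < 40" "L k \<in> set (ports j)"
  shows "k < 5" "j = lterm ! k" "I (lterm ! (4 - k)) \<notin> set (ports j)"
  using row_ok[OF assms(1)] assms(2) by (auto simp: row_ok_def list_all_iff)

lemma ports_R:
  assumes "j < 40" "R k \<in> set (ports j)"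
  shows "k < 5" "j = rterm ! k" "I (rterm ! (4 - k)) \<notin> set (ports j)"
  using row_ok[OF assms(1)] assms(2) by (auto simp: row_ok_def list_all_iff)

lemma ports_one_external:
  assumes "j < 40" "p \<in> set (ports j)" "q \<in> set (ports j)" "p \<noteq> q"
  shows "(\<exists>k. p = I k) \<or> (\<exists>k. q = I k)"
proof (rule ccontr)
  let ?ext = "\<lambda>p. case p of I k \<Rightarrow> False | _ \<Rightarrow> True"
  assume "\<not> ?thesis"
  then have "{p, q} \<subseteq> set (filter ?ext (ports j))"
    using assms by (auto split: port.splits)
  then have "card {p, q} \<le> card (set (filter ?ext (ports j)))"
    by (intro card_mono) auto
  also have "\<dots> \<le> length (filter ?ext (ports j))" by (rule card_length)
  finally show False
    using assms(4) row_ok[OF assms(1)] by (simp add: row_ok_def)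
qed

lemma vtx_eq_iff:
  assumes "j < 40" "k < 40"
  shows "vtx i j = vtx i' k \<longleftrightarrow> i = i' \<and> j = k"
proof
  assume "vtx i j = vtx i' k"
  then have "40 * i + j = 40 * i' + k" by (simp add: vtx_def)
  moreover have "(40 * i + j) div 40 = i" "(40 * i' + k) div 40 = i'" using assms by simp_all
  ultimately show "i = i' \<and> j = k" by auto
qed simp

lemma vtx_neq [simp]: "vtx i j \<noteq> 0" "0 \<noteq> vtx i j"
  by (simp_all add: vtx_def)

lemma vtx_less: "i < n \<Longrightarrow> j < 40 \<Longrightarrow> vtx i j < Suc (40 * n)"
  by (simp add: vtx_def)

lemma nbrs_vtx:
  assumes "i < n" "j < 40"
  shows "nbrs n (vtx i j) = map (target n i) (ports j)"
  using assms vtx_less[OF assms] by (simp add: nbrs_def) (simp add: vtx_def)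

lemma vertex_cases:
  assumes "v \<in> {..Suc (40 * n)}"
  obtains "v = 0" | "v = Suc (40 * n)" | i j where "i < n" "j < 40" "v = vtx i j"
proof -
  consider "v = 0" | "v = Suc (40 * n)" | "0 < v" "v \<le> 40 * n"
    using assms by force
  then show ?thesis
  proof cases
    case 3
    have "(v - 1) div 40 < n" "(v - 1) mod 40 < 40" "v = vtx ((v - 1) div 40) ((v - 1) mod 40)"
      using 3 by (auto simp: vtx_def)
    then show ?thesis using that by blast
  qed (use that in blast)+
qed

lemma nbrs_0: "set (nbrs n 0) = {vtx 0 (lterm ! k) | k. k \<in> {1, 2, 3}}"
  by (auto simp: nbrs_def)

lemma nbrs_last: "set (nbrs n (Suc (40 * n))) = {vtx (n - 1) (rterm ! k) | k. k \<in> {1, 2, 3}}"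
  by (auto simp: nbrs_def)

text \<open>A labeling of the half-edges of one layer that can be repeated in all layers: the two
  halves of an edge agree, also across an interface and on the edge joining strands 0 and 4 at the
  left end.\<close>

definition consistent :: "(nat \<Rightarrow> port \<Rightarrow> 'a) \<Rightarrow> bool" where
  "consistent w \<longleftrightarrow>
    (\<forall>j<40. \<forall>k. I k \<in> set (ports j) \<longrightarrow> w j (I k) = w k (I j)) \<and>
    (\<forall>k<5. w (lterm ! k) (L k) = w (rterm ! k) (R k)) \<and>
    w (lterm ! 0) (L 0) = w (lterm ! 4) (L 4)"

lemma consistent_right:
  assumes "consistent w"
  shows "w (rterm ! 0) (R 0) = w (rterm ! 4) (R 4)"
proof -
  have "\<forall>k<5. w (lterm ! k) (L k) = w (rterm ! k) (R k)"
    and "w (lterm ! 0) (L 0) = w (lterm ! 4) (L 4)"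
    using assms unfolding consistent_def by blast+
  from this(1)[rule_format, of 0] this(1)[rule_format, of 4] this(2) show ?thesis by simp
qed

text \<open>The two ports are the halves of one edge. \<open>T\<close> only fixes the type of the
  labels.\<close>

definition mates :: "nat \<Rightarrow> nat \<Rightarrow> nat \<Rightarrow> port \<Rightarrow> nat \<Rightarrow> nat \<Rightarrow> port \<Rightarrow> 'a itself \<Rightarrow> bool" where
  "mates n i j p i' j' p' T \<longleftrightarrow> i' < n \<and> j' < 40 \<and> p' \<in> set (ports j') \<and>
    target n i p = vtx i' j' \<and> target n i' p' = vtx i j \<and>
    (\<forall>w :: nat \<Rightarrow> port \<Rightarrow> 'a. consistent w \<longrightarrow> w j p = w j' p')"

text \<open>This case analysis yields both the symmetry of adjacency and the well-definedness of
  edge labels.\<close>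

lemma target_cases:
  fixes T :: "'a itself"
  assumes n: "i < n" "j < 40" and p: "p \<in> set (ports j)"
  obtains (left) k where "k \<in> {1, 2, 3}" "i = 0" "j = lterm ! k" "p = L k" "target n i p = 0"
  | (right) k where "k \<in> {1, 2, 3}" "Suc i = n" "j = rterm ! k" "p = R k"
      "target n i p = Suc (40 * n)"
  | (inner) i' j' p' where "mates n i j p i' j' p' T"
proof (cases p)
  case (I k)
  then have "mates n i j p i k (I j) T"
    using ports_I[OF n(2), of k] p n by (auto simp: mates_def consistent_def)
  then show ?thesis by (rule inner)
next
  case (L k)
  then have k: "k < 5" "j = lterm ! k" using ports_L[OF n(2), of k] p by auto
  show ?thesis
  proof (cases "i = 0")
    case True
    consider "k = 0" | "k = 4" | "k \<in> {1, 2, 3}" using k by fastforce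
    then show ?thesis
    proof cases
      case 1
      then have "mates n i j p 0 (lterm ! 4) (L 4) T"
        using True n L k term_ok[of 4] by (auto simp: mates_def consistent_def)
      then show ?thesis by (rule inner)
    next
      case 2
      then have "mates n i j p 0 (lterm ! 0) (L 0) T"
        using True n L k term_ok[of 0] by (auto simp: mates_def consistent_def)
      then show ?thesis by (rule inner)
    next
      case 3
      then show ?thesis using True L k by (intro left[of k]) auto
    qed
  next
    case False
    then have "mates n i j p (i - 1) (rterm ! k) (R k) T"
      using n L k term_ok[of k] by (auto simp: mates_def consistent_def)
    then show ?thesis by (rule inner)
  qed
next
  case (R k)
  then have k: "k < 5" "j = rterm ! k" using ports_R[OF n(2), of k] p by auto
  show ?thesis
  proof (cases "Suc i = n")
    case True
    consider "k = 0" | "k = 4" | "k \<in> {1, 2, 3}" using k by fastforce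
    then show ?thesis
    proof cases
      case 1
      then have "mates n i j p i (rterm ! 4) (R 4) T"
        using True n R k term_ok[of 4] by (auto simp: mates_def consistent_right)
      then show ?thesis by (rule inner)
    next
      case 2
      then have "mates n i j p i (rterm ! 0) (R 0) T"
        using True n R k term_ok[of 0] by (auto simp: mates_def consistent_right)
      then show ?thesis by (rule inner)
    next
      case 3
      then show ?thesis using True R k by (intro right[of k]) auto
    qed
  next
    case False
    then have "mates n i j p (Suc i) (lterm ! k) (L k) T"
      using n R k term_ok[of k] by (auto simp: mates_def consistent_def)
    then show ?thesis by (rule inner)
  qed
qed

lemma target_sym:
  assumes n: "i < n" "j < 40" and p: "p \<in> set (ports j)"
  shows "target n i p \<in> {..Suc (40 * n)} \<and> vtx i j \<in> set (nbrs n (target n i p))"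
  using n p
proof (cases rule: target_cases[where T = "TYPE(unit)"])
  case (left k)
  then show ?thesis by (auto simp: nbrs_0)
next
  case (right k)
  then have "i = n - 1" by simp
  with right show ?thesis unfolding right(5) nbrs_last by auto
next
  case (inner i' j' p')
  then have ij: "i' < n" "j' < 40" "target n i p = vtx i' j'" and "vtx i j = target n i' p'"
    "p' \<in> set (ports j')" by (auto simp: mates_def)
  then show ?thesis
    using vtx_less[OF ij(1,2)] unfolding ij(3) nbrs_vtx[OF ij(1,2)] by auto
qed

text \<open>The case \<open>k = j\<close> excludes loops; the case of another port
  \<open>I k\<close> excludes parallel edges.\<close>

lemma target_neq_I:
  assumes n: "i < n" "j < 40" and "k < 40" and p: "p \<in> set (ports j)" "p \<noteq> I k"
    and k: "k = j \<or> I k \<in> set (ports j)"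
  shows "target n i p \<noteq> vtx i k"
proof (cases p)
  case (I m)
  then show ?thesis using ports_I[OF n(2), of m] p \<open>k < 40\<close> k by (auto simp: vtx_eq_iff)
next
  case (L m)
  then have m: "m < 5" "j = lterm ! m" "I (lterm ! (4 - m)) \<notin> set (ports j)"
    using ports_L[OF n(2), of m] p by auto
  have "lterm ! 4 \<noteq> lterm ! 0" by (simp add: lterm_def)
  then show ?thesis
    using L m k \<open>k < 40\<close> term_ok[of 4] term_ok[of 0] term_ok[of m] by (auto simp: vtx_eq_iff)
next
  case (R m)
  then have m: "m < 5" "j = rterm ! m" "I (rterm ! (4 - m)) \<notin> set (ports j)"
    using ports_R[OF n(2), of m] p by auto
  have "rterm ! 4 \<noteq> rterm ! 0" by (simp add: rterm_def)
  moreover have "vtx i k \<noteq> Suc (40 * n)" using vtx_less[OF n(1) \<open>k < 40\<close>] by simp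
  ultimately show ?thesis
    using R m k \<open>k < 40\<close> term_ok[of 4] term_ok[of 0] term_ok[of m] by (auto simp: vtx_eq_iff)
qed

lemma target_inj:
  assumes "i < n" "j < 40"
  shows "inj_on (target n i) (set (ports j))"
proof (rule inj_onI, rule ccontr)
  fix p q assume pq: "p \<in> set (ports j)" "q \<in> set (ports j)" "target n i p = target n i q" "p \<noteq> q"
  then consider k where "p = I k" | k where "q = I k"
    using ports_one_external[OF assms(2)] by blast
  then show False
  proof cases
    case 1
    then have "target n i q \<noteq> vtx i k" using pq assms ports_I[OF assms(2), of k] by (intro target_neq_I[of _ _ j]) auto
    with 1 pq show False by simp
  next
    case 2
    then have "target n i p \<noteq> vtx i k" using pq assms ports_I[OF assms(2), of k] by (intro target_neq_I[of _ _ j]) auto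
    with 2 pq show False by simp
  qed
qed

lemma cubic_nbrs_chain:
  assumes "1 \<le> n"
  shows "cubic_nbrs {..Suc (40 * n)} (nbrs n)"
proof
  fix v u assume v: "v \<in> {..Suc (40 * n)}" and u: "u \<in> set (nbrs n v)"
  have "u \<in> {..Suc (40 * n)} \<and> v \<in> set (nbrs n u)"
    using v
  proof (cases rule: vertex_cases)
    case 1
    then obtain k where k: "k \<in> {1, 2, 3}" "u = vtx 0 (lterm ! k)"
      using u by (auto simp: nbrs_0)
    then have "target n 0 (L k) \<in> set (nbrs n u)" "u < Suc (40 * n)"
      using assms term_ok[of k] vtx_less[of 0 n "lterm ! k"]
      by (auto simp: nbrs_vtx simp del: target.simps)
    then show ?thesis using 1 k by auto
  next
    case 2
    then obtain k where k: "k \<in> {1, 2, 3}" "u = vtx (n - 1) (rterm ! k)"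
      using u by (auto simp: nbrs_last)
    then have "target n (n - 1) (R k) \<in> set (nbrs n u)" "u < Suc (40 * n)"
      using assms term_ok[of k] vtx_less[of "n - 1" n "rterm ! k"]
      by (auto simp: nbrs_vtx simp del: target.simps)
    then show ?thesis using 2 k assms by auto
  next
    case (3 i j)
    then show ?thesis using u target_sym[OF 3(1,2)] by (auto simp: nbrs_vtx)
  qed
  then show "u \<in> {..Suc (40 * n)}" "v \<in> set (nbrs n u)" by auto
next
  fix v assume v: "v \<in> {..Suc (40 * n)}"
  have "v \<notin> set (nbrs n v) \<and> length (nbrs n v) = 3 \<and> distinct (nbrs n v)"
    using v
  proof (cases rule: vertex_cases)
    case 1
    then show ?thesis by (auto simp: nbrs_def lterm_def vtx_def)
  next
    case 2
    then show ?thesis by (auto simp: nbrs_def rterm_def vtx_def)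
  next
    case (3 i j)
    have "target n i p \<noteq> vtx i j" if "p \<in> set (ports j)" for p
      using that 3 ports_I(2)[OF 3(2), of j] by (intro target_neq_I[of _ _ j]) auto
    then have "vtx i j \<notin> set (nbrs n (vtx i j))"
      using 3 by (force simp: nbrs_vtx)
    then show ?thesis
      using 3 row_ok[of j] target_inj[of i n j]
      by (simp add: nbrs_vtx distinct_map row_ok_def)
  qed
  then show "v \<notin> set (nbrs n v)" "length (nbrs n v) = 3" "distinct (nbrs n v)" by auto
qed simp

text \<open>The neighbors of both end vertices lie in layers, so every edge can be read from a layer
  vertex.\<close>

lemma chain_edgeE:
  assumes "1 \<le> n" "e \<in> edges (chain n)"
  obtains i j p where "i < n" "j < 40" "p \<in> set (ports j)" "e = {vtx i j, target n i p}"
proof -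
  interpret cubic_nbrs "{..Suc (40 * n)}" "nbrs n" using assms(1) by (rule cubic_nbrs_chain)
  obtain v u where vu: "e = {v, u}" "v \<in> {..Suc (40 * n)}" "u \<in> set (nbrs n v)"
    using assms(2) unfolding chain_def edges_G by blast
  from vu(2) show ?thesis
  proof (cases rule: vertex_cases)
    case 1
    then obtain k where k: "k \<in> {1, 2, 3}" "u = vtx 0 (lterm ! k)"
      using vu by (auto simp: nbrs_0)
    then have "e = {vtx 0 (lterm ! k), target n 0 (L k)}" "k < 5" using vu 1 by auto
    then show ?thesis using assms(1) term_ok[of k] by (intro that[of 0 "lterm ! k" "L k"]) auto
  next
    case 2
    then obtain k where k: "k \<in> {1, 2, 3}" "u = vtx (n - 1) (rterm ! k)"
      using vu by (auto simp: nbrs_last)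
    then have "e = {vtx (n - 1) (rterm ! k), target n (n - 1) (R k)}" "k < 5"
      using vu 2 assms(1) by auto
    then show ?thesis
      using assms(1) term_ok[of k] by (intro that[of "n - 1" "rterm ! k" "R k"]) auto
  next
    case (3 i j)
    then obtain p where "p \<in> set (ports j)" "u = target n i p"
      using vu by (auto simp: nbrs_vtx)
    then show ?thesis using 3 vu by (intro that[of i j p]) auto
  qed
qed

subsection \<open>Every flow vanishes somewhere in each layer\<close>

lemma bit_pair_add_left_self [simp]: "a + (a + b) = (b :: bit \<times> bit)"
  by (simp flip: add.assoc)

text \<open>The vertices are 0 to 7 together with \<open>u\<close> (adjacent to 0, 1, 2) and \<open>v\<close> (adjacent to 1, 3, 7).
  The check enumerates a flow from its values on six edges that determine it.\<close>

definition petersen_check :: bool where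
  "petersen_check =
    (let V = [(1, 0), (0, 1), (1, 1) :: bit \<times> bit] in
     list_all (\<lambda>l0. list_all (\<lambda>l1. if l0 = l1 then True else
     list_all (\<lambda>e06. if l0 = e06 then True else
     list_all (\<lambda>e15. if l1 = e15 then True else
     list_all (\<lambda>e23. if l0 + l1 = e23 then True else
     list_all (\<lambda>e36. if e23 = e36 \<or> e06 = e36 then True else
       (let e24 = l0 + l1 + e23; e07 = l0 + e06; e56 = e06 + e36; e45 = e15 + e56; e47 = e24 + e45
        in e45 = 0 \<or> e47 = 0 \<or> e07 + e47 = 0 \<or> l1 + e15 + (e23 + e36) + (e07 + e47) \<noteq> 0))
     V) V) V) V) V) V)"

lemma petersen_check: petersen_check
  by code_simp

text \<open>The edges at \<open>u\<close> are \<open>l0\<close>, \<open>l1\<close>,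
  \<open>l2\<close>, those at \<open>v\<close> are \<open>r1\<close>, \<open>r3\<close>,
  \<open>r7\<close>; the premises are the ten vertex equations.\<close>

lemma petersen_no_nowhere_zero_flow:
  fixes l0 l1 l2 r1 r3 r7 e06 e07 e15 e23 e24 e36 e45 e47 e56 :: "bit \<times> bit"
  assumes "l0 + l1 + l2 = 0" "l0 + e06 + e07 = 0" "l1 + e15 + r1 = 0" "l2 + e23 + e24 = 0"
    "e23 + e36 + r3 = 0" "e24 + e45 + e47 = 0" "e15 + e45 + e56 = 0" "e06 + e36 + e56 = 0"
    "e07 + e47 + r7 = 0" "r1 + r3 + r7 = 0"
  shows "0 \<in> {l0, l1, l2, r1, r3, r7, e06, e07, e15, e23, e24, e36, e45, e47, e56}"
proof (rule ccontr)
  let ?V = "[(1, 0), (0, 1), (1, 1) :: bit \<times> bit]"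
  assume "\<not> ?thesis"
  then have nz: "l0 \<noteq> 0" "l1 \<noteq> 0" "l2 \<noteq> 0" "r1 \<noteq> 0" "r3 \<noteq> 0" "r7 \<noteq> 0" "e06 \<noteq> 0" "e07 \<noteq> 0"
    "e15 \<noteq> 0" "e23 \<noteq> 0" "e24 \<noteq> 0" "e36 \<noteq> 0" "e45 \<noteq> 0" "e47 \<noteq> 0" "e56 \<noteq> 0" by auto
  have V: "a \<in> set ?V" if "a \<noteq> 0" for a
    using that by (cases a) (auto simp: zero_prod_def)
  \<comment> \<open>Nine equations express nine edges through the six enumerated ones; the equation
    at \<open>v\<close> remains to be refuted.\<close>
  have eqs: "l2 = l0 + l1" "e07 = l0 + e06" "r1 = l1 + e15" "e24 = l2 + e23" "r3 = e23 + e36"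
    "e47 = e24 + e45" "e45 = e15 + e56" "e56 = e06 + e36" "r7 = e07 + e47"
    using assms(1-9) by (auto simp: bit_pair_add_eq_0_iff add.assoc)
  \<comment> \<open>The pruning tests of the check: they hold because \<open>l2\<close>,
    \<open>e07\<close>, \<open>r1\<close>, \<open>e24\<close>, \<open>r3\<close> and
    \<open>e56\<close> are nonzero.\<close>
  have ne: "l0 \<noteq> l1" "l0 \<noteq> e06" "l1 \<noteq> e15" "l0 + l1 \<noteq> e23" "e23 \<noteq> e36" "e06 \<noteq> e36"
    using nz eqs by (metis bit_pair_add_self)+
  have "petersen_check" by (rule petersen_check)
  then have "e45 = 0 \<or> e47 = 0 \<or> e07 + e47 = 0 \<or> l1 + e15 + (e23 + e36) + (e07 + e47) \<noteq> 0"
    using V[OF nz(1)] V[OF nz(2)] V[OF nz(7)] V[OF nz(9)] V[OF nz(10)] V[OF nz(12)] ne eqs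
    unfolding petersen_check_def Let_def list_all_iff by metis
  then show False using nz assms(10) eqs(3,5,9) by metis
qed

text \<open>The vertex equations of the gadgets \<open>M\<close> (the Petersen graph above without \<open>u\<close> and \<open>v\<close>) and \<open>N\<close>,
  with vertices 0 to 7 and 0 to 6, respectively; \<open>l\<close> and \<open>r\<close> are the values on the left and right
  connector, \<open>s\<close> is the value on the residual edge.\<close>

definition M_pole where
  "M_pole l0 l1 l2 r1 r3 r7 (e :: nat \<Rightarrow> nat \<Rightarrow> bit \<times> bit) \<longleftrightarrow>
    l0 + e 0 6 + e 0 7 = 0 \<and> l1 + e 1 5 + r1 = 0 \<and> l2 + e 2 3 + e 2 4 = 0 \<and>
    e 2 3 + e 3 6 + r3 = 0 \<and> e 2 4 + e 4 5 + e 4 7 = 0 \<and> e 1 5 + e 4 5 + e 5 6 = 0 \<and>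
    e 0 6 + e 3 6 + e 5 6 = 0 \<and> e 0 7 + e 4 7 + r7 = 0"

text \<open>In the sum of all vertex equations each internal edge occurs twice and cancels.\<close>

lemma M_pole_sum:
  assumes "M_pole l0 l1 l2 r1 r3 r7 e"
  shows "l0 + l1 + l2 = r1 + r3 + r7"
proof -
  have "l0 + l1 + l2 + (r1 + r3 + r7) =
     (l0 + e 0 6 + e 0 7) + (l1 + e 1 5 + r1) + (l2 + e 2 3 + e 2 4) + (e 2 3 + e 3 6 + r3) +
     (e 2 4 + e 4 5 + e 4 7) + (e 1 5 + e 4 5 + e 5 6) + (e 0 6 + e 3 6 + e 5 6) + (e 0 7 + e 4 7 + r7)"
    by (simp add: ac_simps)
  also have "\<dots> = 0"
    using assms by (simp only: M_pole_def add_0)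
  finally show ?thesis by (simp only: bit_pair_add_eq_0_iff)
qed

lemma M_pole_nonzero:
  assumes "M_pole l0 l1 l2 r1 r3 r7 e"
    and "0 \<notin> {l0, l1, l2, r1, r3, r7, e 0 6, e 0 7, e 1 5, e 2 3, e 2 4, e 3 6, e 4 5, e 4 7, e 5 6}"
  shows "l0 + l1 + l2 \<noteq> 0"
proof
  assume sum: "l0 + l1 + l2 = 0"
  then have "r1 + r3 + r7 = 0" using M_pole_sum[OF assms(1)] by simp
  then show False
    using petersen_no_nowhere_zero_flow[OF sum] assms unfolding M_pole_def by blast
qed

definition N_pole where
  "N_pole l0 l1 r3 r6 s (e :: nat \<Rightarrow> nat \<Rightarrow> bit \<times> bit) \<longleftrightarrow>
    l0 + e 0 5 + e 0 6 = 0 \<and> l1 + e 1 2 + e 1 3 = 0 \<and> e 1 2 + e 2 4 + e 2 6 = 0 \<and>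
    e 1 3 + e 3 5 + r3 = 0 \<and> e 2 4 + e 4 5 + s = 0 \<and> e 0 5 + e 3 5 + e 4 5 = 0 \<and>
    e 0 6 + e 2 6 + r6 = 0"

lemma N_pole_sum:
  assumes "N_pole l0 l1 r3 r6 s e"
  shows "l0 + l1 + (r3 + r6) = s"
proof -
  have "l0 + l1 + (r3 + r6) + s = (l0 + e 0 5 + e 0 6) + (l1 + e 1 2 + e 1 3) +
      (e 1 2 + e 2 4 + e 2 6) + (e 1 3 + e 3 5 + r3) + (e 2 4 + e 4 5 + s) +
      (e 0 5 + e 3 5 + e 4 5) + (e 0 6 + e 2 6 + r6)"
    by (simp add: ac_simps)
  also have "\<dots> = 0"
    using assms by (simp only: N_pole_def add_0)
  finally show ?thesis by (simp only: bit_pair_add_eq_0_iff)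
qed

text \<open>Restore the deleted path and give its two edges the connector sums. Were both nonzero,
  the Petersen graph would have a nowhere-zero flow.\<close>

lemma N_pole_zero:
  assumes N: "N_pole l0 l1 r3 r6 s e"
    and "0 \<notin> {l0, l1, r3, r6, s, e 0 5, e 0 6, e 1 2, e 1 3, e 2 4, e 2 6, e 3 5, e 4 5}"
  shows "l0 + l1 = 0 \<or> r3 + r6 = 0"
proof (rule ccontr)
  assume nz: "\<not> ?thesis"
  have "(l0 + l1) + (r3 + r6) + s = 0" using N_pole_sum[OF N] by simp
  moreover have "l0 + l1 + (l0 + l1) = 0" "r6 + (r3 + r6) + r3 = 0" by (simp_all add: ac_simps)
  \<comment> \<open>In the labeling of the Petersen graph above, the deleted path is 2, 4, 5, while
    \<open>u\<close> and \<open>v\<close> are the vertices 0 and 2 of the gadget.\<close>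
  ultimately show False
    using petersen_no_nowhere_zero_flow[of "e 0 5" "e 0 6" l0 "e 3 5" "e 4 5" r6 "e 2 6" l1 "l0 + l1"
        "e 1 3" "e 1 2" "r3 + r6" s r3 "e 2 4"] N assms(2) nz
    by (auto simp: N_pole_def ac_simps)
qed

section \<open>Flows within a single layer\<close>

locale layer_flow =
  fixes h :: "nat \<Rightarrow> port \<Rightarrow> bit \<times> bit"
  assumes sym: "h j (I k) = h k (I j)"
    and vertex_sum: "j < 40 \<Longrightarrow> (\<Sum>p\<leftarrow>ports j. h j p) = 0"
begin

lemma vertex_sums: "list_all (\<lambda>(j, ps). (\<Sum>p\<leftarrow>ps. h j p) = 0) (enumerate 0 port_table)"
proof -
  have "length port_table = 40" by (simp add: port_table_def)
  then show ?thesis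
    using vertex_sum by (auto simp: list_all_iff in_set_enumerate_eq ports_def)
qed

lemma poles:
  "M_pole (h 0 (L 0)) (h 1 (L 1)) (h 2 (L 2)) (h 1 (I 15)) (h 3 (I 18)) (h 7 (I 16)) (\<lambda>a b. h a (I b))"
  "N_pole (h 8 (L 3)) (h 9 (L 4)) (h 11 (I 25)) (h 14 (I 24)) (h 12 (I 15)) (\<lambda>a b. h (8 + a) (I (8 + b)))"
  "M_pole (h 16 (I 7)) (h 17 (I 15)) (h 18 (I 3)) (h 17 (I 31)) (h 19 (I 34)) (h 23 (I 32))
    (\<lambda>a b. h (16 + a) (I (16 + b)))"
  "N_pole (h 24 (I 14)) (h 25 (I 11)) (h 27 (R 4)) (h 30 (R 3)) (h 28 (I 31)) (\<lambda>a b. h (24 + a) (I (24 + b)))"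
  "M_pole (h 32 (I 23)) (h 33 (I 31)) (h 34 (I 19)) (h 33 (R 2)) (h 35 (R 1)) (h 39 (R 0))
    (\<lambda>a b. h (32 + a) (I (32 + b)))"
  "h 15 (I 1) + h 15 (I 12) + h 15 (I 17) = 0"
  "h 31 (I 17) + h 31 (I 28) + h 31 (I 33) = 0"
  using vertex_sums unfolding M_pole_def N_pole_def port_table_def
  by (simp_all add: ac_simps sym flip: numeral_2_eq_2)

lemma sum_left_eq_sum_right:
  "h 0 (L 0) + h 1 (L 1) + h 2 (L 2) + h 8 (L 3) + h 9 (L 4) =
   h 39 (R 0) + h 35 (R 1) + h 33 (R 2) + h 30 (R 3) + h 27 (R 4)"
proof -
  have "h 0 (L 0) + h 1 (L 1) + h 2 (L 2) + h 8 (L 3) + h 9 (L 4) +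
     (h 39 (R 0) + h 35 (R 1) + h 33 (R 2) + h 30 (R 3) + h 27 (R 4)) =
     (h 0 (L 0) + h 1 (L 1) + h 2 (L 2) + (h 1 (I 15) + h 3 (I 18) + h 7 (I 16))) +
     (h 8 (L 3) + h 9 (L 4) + (h 11 (I 25) + h 14 (I 24)) + h 12 (I 15)) +
     (h 16 (I 7) + h 17 (I 15) + h 18 (I 3) + (h 17 (I 31) + h 19 (I 34) + h 23 (I 32))) +
     (h 24 (I 14) + h 25 (I 11) + (h 27 (R 4) + h 30 (R 3)) + h 28 (I 31)) +
     (h 32 (I 23) + h 33 (I 31) + h 34 (I 19) + (h 33 (R 2) + h 35 (R 1) + h 39 (R 0))) +
     (h 15 (I 1) + h 15 (I 12) + h 15 (I 17)) + (h 31 (I 17) + h 31 (I 28) + h 31 (I 33))"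
    by (simp add: ac_simps sym)
  also have "\<dots> = 0"
    by (simp only: poles(1,3,5)[THEN M_pole_sum] poles(2,4)[THEN N_pole_sum] poles(6,7)
        bit_pair_add_self add_0)
  finally show ?thesis by (simp only: bit_pair_add_eq_0_iff)
qed

text \<open>Right strands are excluded so that the zeros found in different layers are different
  edges.\<close>

lemma zero_in_layer:
  assumes "h 0 (L 0) + h 1 (L 1) + h 2 (L 2) + h 8 (L 3) + h 9 (L 4) = 0"
  shows "\<exists>j<40. \<exists>p\<in>set (ports j). (\<forall>k. p \<noteq> R k) \<and> h j p = 0"
proof (rule ccontr)
  assume *: "\<not> ?thesis"
  have "length port_table = 40" by (simp add: port_table_def)
  then have "list_all (\<lambda>(j, ps). list_all (\<lambda>p. (\<exists>k. p = R k) \<or> h j p \<noteq> 0) ps) (enumerate 0 port_table)"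
    using * by (fastforce simp: list_all_iff in_set_enumerate_eq ports_def)
  note nz = this[unfolded port_table_def]
  let ?a = "h 0 (L 0) + h 1 (L 1) + h 2 (L 2)"
  have "?a \<noteq> 0"
    by (rule M_pole_nonzero[OF poles(1)]) (use nz in \<open>simp add: sym flip: numeral_2_eq_2\<close>)
  moreover have t: "h 8 (L 3) + h 9 (L 4) = ?a"
    using assms by (simp add: bit_pair_add_eq_0_iff add.assoc)
  moreover have "h 8 (L 3) + h 9 (L 4) = 0 \<or> h 11 (I 25) + h 14 (I 24) = 0"
    by (rule N_pole_zero[OF poles(2)]) (use nz in \<open>simp add: sym flip: numeral_2_eq_2\<close>)
  ultimately have "h 11 (I 25) + h 14 (I 24) = 0" by simp
  then have "h 12 (I 15) = ?a" using N_pole_sum[OF poles(2)] t by simp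
  moreover have "?a = h 1 (I 15) + h 3 (I 18) + h 7 (I 16)" by (rule M_pole_sum[OF poles(1)])
  moreover have "h 16 (I 7) + h 17 (I 15) + h 18 (I 3) \<noteq> 0"
    by (rule M_pole_nonzero[OF poles(3)]) (use nz in \<open>simp add: sym flip: numeral_2_eq_2\<close>)
  moreover have "h 17 (I 15) = h 1 (I 15) + h 12 (I 15)"
    using poles(6) by (simp add: sym bit_pair_add_eq_0_iff)
  \<comment> \<open>Vertex 15 adds the residual value \<open>?a\<close> to the strand from vertex 1,
    so the strands entering the second M sum to \<open>?a + ?a = 0\<close>.\<close>
  ultimately show False by (simp add: sym ac_simps)
qed

end

lemma chain_flow_zeros:
  assumes n: "1 \<le> n" and f: "is_flow (chain n) f"
  shows "n \<le> card {e \<in> edges (chain n). f e = 0}"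
proof -
  interpret cubic_nbrs "{..Suc (40 * n)}" "nbrs n" using n by (rule cubic_nbrs_chain)
  define h where "h i j p = f {vtx i j, target n i p}" for i j p
  have vertex: "(\<Sum>u\<leftarrow>nbrs n v. f {v, u}) = 0" if "v \<le> Suc (40 * n)" for v
    using f that sum_incident_edges[of v f] by (simp add: is_flow_def chain_def)
  have layer: "layer_flow (h i)" if i: "i < n" for i
  proof
    show "h i j (I k) = h i k (I j)" for j k
      by (simp add: h_def insert_commute)
    fix j :: nat assume j: "j < 40"
    show "(\<Sum>p\<leftarrow>ports j. h i j p) = 0"
      using vertex[of "vtx i j"] vtx_less[OF i j] by (simp add: nbrs_vtx[OF i j] h_def comp_def)
  qed
  \<comment> \<open>At the left end strands 0 and 4 are a single edge and cancel, while strands 1,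
    2, 3 meet in a vertex. Each layer passes its strand sum on.\<close>
  have left: "h i 0 (L 0) + h i 1 (L 1) + h i 2 (L 2) + h i 8 (L 3) + h i 9 (L 4) = 0" if "i < n" for i
    using that
  proof (induction i)
    case 0
    have "f {vtx 0 1, 0} + (f {vtx 0 2, 0} + f {vtx 0 8, 0}) = 0"
      using vertex[of 0] by (simp add: nbrs_def lterm_def insert_commute)
    then show ?case by (simp add: h_def lterm_def insert_commute ac_simps)
  next
    case (Suc i)
    have "h (Suc i) (lterm ! k) (L k) = h i (rterm ! k) (R k)" for k
      using Suc.prems by (simp add: h_def insert_commute)
    from this[of 0] this[of 1] this[of 2] this[of 3] this[of 4] show ?case
      using layer_flow.sum_left_eq_sum_right[OF layer[of i]] Suc by (simp add: lterm_def rterm_def)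
  qed
  define Z where "Z = {e \<in> edges (chain n). f e = 0}"
  have finZ: "finite Z"
    using simple_graph_finite_edges[OF simple] by (simp add: Z_def chain_def)
  \<comment> \<open>\<open>(Max e - 1) div 40\<close> is the layer of the larger end; an edge at
    layer \<open>i\<close> that is not a right strand has its larger end in that layer.\<close>
  have "{..<n} \<subseteq> (\<lambda>e. (Max e - 1) div 40) ` Z"
  proof
    fix i assume "i \<in> {..<n}"
    then have i: "i < n" by simp
    obtain j p where jp: "j < 40" "p \<in> set (ports j)" "\<forall>k. p \<noteq> R k" "h i j p = 0"
      using layer_flow.zero_in_layer[OF layer[OF i] left[OF i]] by blast
    let ?e = "{vtx i j, target n i p}"
    have "?e \<in> edges G"
      unfolding edges_G using jp i vtx_less[OF i jp(1)]
      by (intro CollectI exI[of _ "vtx i j"] exI[of _ "target n i p"]) (auto simp: nbrs_vtx)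
    then have "?e \<in> Z" using jp by (simp add: Z_def h_def chain_def)
    moreover have "target n i p \<le> 40 * i + 40"
    proof (cases p)
      case (I k)
      then show ?thesis using ports_I[OF jp(1), of k] jp(2) by (simp add: vtx_def)
    next
      case (L k)
      then have "k < 5" using ports_L[OF jp(1), of k] jp(2) by simp
      then show ?thesis using L term_ok[of k] term_ok(1)[of 0] term_ok(1)[of 4] by (auto simp: vtx_def)
    next
      case (R k)
      then show ?thesis using jp(3) by simp
    qed
    then have "40 * i \<le> Max ?e - 1" "Max ?e - 1 < 40 * i + 40"
      using jp(1) by (auto simp: vtx_def max_def)
    then have "(Max ?e - 1) div 40 = i" by (intro div_nat_eqI) (auto simp: mult.commute)
    ultimately show "i \<in> (\<lambda>e. (Max e - 1) div 40) ` Z" by (intro image_eqI[of _ _ ?e]) auto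
  qed
  then have "card {..<n} \<le> card Z" using finZ by (rule surj_card_le[rotated])
  then show ?thesis by (simp add: Z_def)
qed

subsection \<open>A flow with one zero per layer and a coloring\<close>

definition port_val :: "nat \<Rightarrow> (nat \<Rightarrow> port \<Rightarrow> 'a) \<Rightarrow> nat \<Rightarrow> nat \<Rightarrow> 'a" where
  "port_val n w v u =
    (let i = (v - 1) div 40; j = (v - 1) mod 40
     in w j (THE p. p \<in> set (ports j) \<and> target n i p = u))"

text \<open>The label is read at the larger end, unless this is the right end vertex, which has no
  ports. The left end vertex 0 is never the larger end.\<close>

definition edge_val :: "nat \<Rightarrow> (nat \<Rightarrow> port \<Rightarrow> 'a) \<Rightarrow> nat set \<Rightarrow> 'a" where
  "edge_val n w e =
    (if Max e = Suc (40 * n) then port_val n w (Min e) (Max e) else port_val n w (Max e) (Min e))"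

lemma port_val:
  assumes "i < n" "j < 40" "p \<in> set (ports j)"
  shows "port_val n w (vtx i j) (target n i p) = w j p"
proof -
  have "(vtx i j - 1) div 40 = i" "(vtx i j - 1) mod 40 = j"
    using assms by (simp_all add: vtx_def)
  moreover have "(THE q. q \<in> set (ports j) \<and> target n i q = target n i p) = p"
    using assms target_inj[of i n j] by (intro the_equality) (auto simp: inj_on_def)
  ultimately show ?thesis by (simp add: port_val_def)
qed

lemma edge_val:
  fixes w :: "nat \<Rightarrow> port \<Rightarrow> 'a"
  assumes w: "consistent w" and n: "i < n" "j < 40" and p: "p \<in> set (ports j)"
  shows "edge_val n w {vtx i j, target n i p} = w j p"
proof -
  have less: "vtx i j < Suc (40 * n)" using n by (rule vtx_less)
  from n p show ?thesis
  proof (cases rule: target_cases[where T = "TYPE('a)"])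
    case (left k)
    then show ?thesis using less port_val[OF n p, of w] by (simp add: edge_val_def)
  next
    case (right k)
    then show ?thesis using less port_val[OF n p, of w] by (simp add: edge_val_def max_def min_def)
  next
    case (inner i' j' p')
    then have i': "i' < n" "j' < 40" "p' \<in> set (ports j')" "target n i p = vtx i' j'"
      "target n i' p' = vtx i j" "w j p = w j' p'"
      using w by (auto simp: mates_def)
    have "vtx i' j' < Suc (40 * n)" using i' by (intro vtx_less)
    then show ?thesis
      using less port_val[OF n p, of w] port_val[OF i'(1-3), of w] i'(4-6)
      by (auto simp: edge_val_def max_def min_def)
  qed
qed

definition table_val :: "nat list list \<Rightarrow> nat \<Rightarrow> port \<Rightarrow> nat" where
  "table_val T j p = the (map_of (zip (ports j) (T ! j)) p)"

definition table_ok :: "nat list list \<Rightarrow> bool" where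
  "table_ok T \<longleftrightarrow> list_all (\<lambda>j. list_all (\<lambda>p. case p of
       I k \<Rightarrow> table_val T j p = table_val T k (I j)
     | L k \<Rightarrow> table_val T j p = table_val T (rterm ! k) (R k)
     | R k \<Rightarrow> True) (ports j)) [0..<40] \<and>
    table_val T (lterm ! 0) (L 0) = table_val T (lterm ! 4) (L 4)"

lemma consistent_table_val:
  assumes "table_ok T"
  shows "consistent (\<lambda>j p. g (table_val T j p))"
proof -
  have *: "case p of I k \<Rightarrow> table_val T j p = table_val T k (I j)
     | L k \<Rightarrow> table_val T j p = table_val T (rterm ! k) (R k) | R k \<Rightarrow> True"
    if "j < 40" "p \<in> set (ports j)" for j p
    using assms that by (auto simp: table_ok_def list_all_iff)
  have 1: "table_val T (lterm ! k) (L k) = table_val T (rterm ! k) (R k)" if "k < 5" for k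
    using *[OF term_ok(1,2)[OF that]] by simp
  have 2: "table_val T j (I k) = table_val T k (I j)" if "j < 40" "I k \<in> set (ports j)" for j k
    using *[OF that] by simp
  have 3: "table_val T (lterm ! 0) (L 0) = table_val T (lterm ! 4) (L 4)"
    using assms by (simp add: table_ok_def)
  show ?thesis
    unfolding consistent_def by (intro conjI allI impI arg_cong[of _ _ g] 1 2 3)
qed

text \<open>Codes, in the sense of \<open>flow_vec\<close>, aligned with the rows of
  \<open>port_table\<close>. The only zero edge joins 3 and 18, on a strand between the first two
  gadgets M.\<close>

definition flow_table :: "nat list list" where
  "flow_table = [
   [1, 2, 3], [1, 2, 3], [2, 1, 3], [1, 1, 0], [3, 1, 2], [2, 1, 3], [2, 1, 3], [3, 2, 1],
   [3, 1, 2], [1, 2, 3], [2, 1, 3], [3, 2, 1], [1, 3, 2], [1, 2, 3], [2, 3, 1], [3, 2, 1],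
   [1, 2, 3], [1, 2, 3], [0, 1, 1], [1, 3, 2], [1, 3, 2], [2, 3, 1], [2, 3, 1], [3, 2, 1],
   [1, 3, 2], [1, 2, 3], [2, 3, 1], [3, 2, 1], [3, 1, 2], [3, 2, 1], [2, 1, 3], [3, 2, 1],
   [1, 3, 2], [1, 3, 2], [2, 3, 1], [3, 2, 1], [1, 2, 3], [3, 2, 1], [3, 2, 1], [2, 3, 1]]"

definition flow_vec :: "nat \<Rightarrow> bit \<times> bit" where
  "flow_vec c = (if c = 0 then (0, 0) else if c = 1 then (1, 0) else if c = 2 then (0, 1) else (1, 1))"

definition layer_flow_val :: "nat \<Rightarrow> port \<Rightarrow> bit \<times> bit" where
  "layer_flow_val j p = flow_vec (table_val flow_table j p)"

lemma flow_table_ok: "table_ok flow_table"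
  by code_simp

lemma flow_table_vertices:
  "list_all (\<lambda>j. (\<Sum>p\<leftarrow>ports j. layer_flow_val j p) = 0 \<and>
     list_all (\<lambda>p. layer_flow_val j p = 0 \<longrightarrow> (j, p) = (3, I 18) \<or> (j, p) = (18, I 3)) (ports j)) [0..<40]"
  by code_simp

lemma flow_table_cap:
  "(\<Sum>k\<leftarrow>[1, 2, 3]. layer_flow_val (lterm ! k) (L k)) = 0"
  "(\<Sum>k\<leftarrow>[1, 2, 3]. layer_flow_val (rterm ! k) (R k)) = 0"
  by code_simp+

lemma chain_flow:
  assumes n: "1 \<le> n"
  defines "f \<equiv> edge_val n layer_flow_val"
  shows "is_flow (chain n) f" and "card {e \<in> edges (chain n). f e = 0} \<le> n"
proof -
  interpret cubic_nbrs "{..Suc (40 * n)}" "nbrs n" using n by (rule cubic_nbrs_chain)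
  have cons: "consistent layer_flow_val"
    using consistent_table_val[OF flow_table_ok, of flow_vec] by (simp add: layer_flow_val_def[abs_def])
  note val = edge_val[OF cons]
  have verts: "(\<Sum>p\<leftarrow>ports j. layer_flow_val j p) = 0"
    "\<And>p. p \<in> set (ports j) \<Longrightarrow> layer_flow_val j p = 0 \<Longrightarrow> (j, p) = (3, I 18) \<or> (j, p) = (18, I 3)"
    if "j < 40" for j
    using flow_table_vertices that by (auto simp: list_all_iff)
  have "(\<Sum>u\<leftarrow>nbrs n v. f {v, u}) = 0" if v: "v \<in> {..Suc (40 * n)}" for v
    using v
  proof (cases rule: vertex_cases)
    case 1
    have "f {0, vtx 0 (lterm ! k)} = layer_flow_val (lterm ! k) (L k)" if "k \<in> {1, 2, 3}" for k
      using val[of 0 n "lterm ! k" "L k"] n term_ok[of k] that by (auto simp: f_def insert_commute)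
    with flow_table_cap(1) 1 show ?thesis by (simp add: nbrs_def)
  next
    case 2
    have "f {Suc (40 * n), vtx (n - 1) (rterm ! k)} = layer_flow_val (rterm ! k) (R k)"
      if "k \<in> {1, 2, 3}" for k
      using val[of "n - 1" n "rterm ! k" "R k"] n term_ok[of k] that by (auto simp: f_def insert_commute)
    with flow_table_cap(2) 2 show ?thesis by (simp add: nbrs_def)
  next
    case (3 i j)
    have "(\<Sum>p\<leftarrow>ports j. f {vtx i j, target n i p}) = (\<Sum>p\<leftarrow>ports j. layer_flow_val j p)"
      using 3 val by (intro arg_cong[of _ _ sum_list] map_cong) (auto simp: f_def)
    with 3 verts(1)[of j] show ?thesis by (simp add: nbrs_vtx comp_def)
  qed
  then show "is_flow (chain n) f"
    by (simp add: is_flow_def chain_def sum_incident_edges)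
  have "{e \<in> edges (chain n). f e = 0} \<subseteq> (\<lambda>i. {vtx i 3, vtx i 18}) ` {..<n}"
  proof
    fix e assume "e \<in> {e \<in> edges (chain n). f e = 0}"
    then have e: "e \<in> edges (chain n)" "f e = 0" by auto
    obtain i j p where ijp: "i < n" "j < 40" "p \<in> set (ports j)" "e = {vtx i j, target n i p}"
      by (rule chain_edgeE[OF n e(1)])
    then have "layer_flow_val j p = 0" using e val[OF ijp(1-3)] by (simp add: f_def)
    then have "e = {vtx i 3, vtx i 18}"
      using verts(2)[OF ijp(2,3)] ijp(4) by (auto simp: insert_commute)
    then show "e \<in> (\<lambda>i. {vtx i 3, vtx i 18}) ` {..<n}" using ijp(1) by auto
  qed
  then have "card {e \<in> edges (chain n). f e = 0} \<le> card ((\<lambda>i. {vtx i 3, vtx i 18}) ` {..<n})"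
    by (intro card_mono) auto
  also have "\<dots> \<le> n" using card_image_le[of "{..<n}"] by fastforce
  finally show "card {e \<in> edges (chain n). f e = 0} \<le> n" .
qed

text \<open>All strands except strand 2 have color 0, so the strand sum is nonzero. An end vertex
  sees the colors 0, 1, 0 on strands 1, 2, 3; deleting strand 1 there removes the conflict.\<close>

definition color_table :: "nat list list" where
  "color_table = [
   [0, 1, 2], [0, 2, 1], [1, 0, 2], [0, 2, 1], [2, 1, 0], [2, 1, 0], [1, 2, 0], [2, 0, 1],
   [0, 1, 2], [0, 2, 1], [2, 1, 0], [1, 0, 2], [1, 2, 0], [1, 0, 2], [2, 0, 1], [1, 0, 2],
   [1, 0, 2], [2, 0, 1], [1, 0, 2], [0, 1, 2], [2, 1, 0], [0, 1, 2], [0, 1, 2], [2, 0, 1],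
   [1, 0, 2], [2, 0, 1], [0, 2, 1], [1, 2, 0], [2, 1, 0], [0, 2, 1], [2, 1, 0], [1, 0, 2],
   [1, 0, 2], [2, 0, 1], [2, 1, 0], [1, 2, 0], [0, 2, 1], [0, 2, 1], [0, 2, 1], [2, 1, 0]]"

lemma color_table_ok: "table_ok color_table"
  by code_simp

lemma color_table_vertices:
  "list_all (\<lambda>j. distinct (map (table_val color_table j) (ports j)) \<and>
     list_all (\<lambda>p. table_val color_table j p < 3) (ports j)) [0..<40]"
  by code_simp

lemma color_table_cap:
  "table_val color_table (lterm ! 2) (L 2) \<noteq> table_val color_table (lterm ! 3) (L 3)"
  "table_val color_table (rterm ! 2) (R 2) \<noteq> table_val color_table (rterm ! 3) (R 3)"
  by code_simp+

lemma chain_coloring: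
  assumes n: "1 \<le> n"
  defines "F \<equiv> {{0, vtx 0 (lterm ! 1)}, {Suc (40 * n), vtx (n - 1) (rterm ! 1)}}"
  shows "F \<subseteq> edges (chain n)" and "edge_colorable 3 (delete_edges (chain n) F)"
proof -
  interpret cubic_nbrs "{..Suc (40 * n)}" "nbrs n" using n by (rule cubic_nbrs_chain)
  have inc: "{v, u} \<in> edges (chain n)" if "v \<le> Suc (40 * n)" "u \<in> set (nbrs n v)" for v u
    unfolding chain_def edges_G using that by auto
  show "F \<subseteq> edges (chain n)"
    by (auto simp: F_def nbrs_0 nbrs_last intro!: inc)
  let ?w = "table_val color_table"
  define c where "c = edge_val n ?w"
  have cons: "consistent ?w"
    using consistent_table_val[OF color_table_ok, of id] by simp
  have val: "c {vtx i j, target n i p} = ?w j p" if "i < n" "j < 40" "p \<in> set (ports j)" for i j p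
    unfolding c_def using cons that by (rule edge_val)
  have verts: "distinct (map (?w j) (ports j))" "\<And>p. p \<in> set (ports j) \<Longrightarrow> ?w j p < 3"
    if "j < 40" for j
    using color_table_vertices that by (auto simp: list_all_iff)
  have "c e < 3" if "e \<in> edges (chain n)" for e
    using n that
  proof (rule chain_edgeE)
    fix i j p assume ijp: "i < n" "j < 40" "p \<in> set (ports j)" "e = {vtx i j, target n i p}"
    then show "c e < 3" using val[OF ijp(1-3)] verts(2)[OF ijp(2,3)] by simp
  qed
  moreover have "c e \<noteq> c e'"
    if e: "e \<in> edges (chain n) - F" "e' \<in> edges (chain n) - F" "e \<noteq> e'" "e \<inter> e' \<noteq> {}" for e e'
  proof -
    obtain v where v: "v \<in> e" "v \<in> e'" using e(4) by auto
    then have vV: "v \<in> {..Suc (40 * n)}"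
      using e(1) simple by (auto simp: simple_graph_def chain_def)
    have "e \<in> incident_edges G v" "e' \<in> incident_edges G v"
      using v e(1,2) by (auto simp: incident_edges_def chain_def)
    then obtain u u' where u: "u \<in> set (nbrs n v)" "e = {v, u}" "u' \<in> set (nbrs n v)" "e' = {v, u'}"
      unfolding incident_edges_G[OF vV] by auto
    from vV show ?thesis
    proof (cases rule: vertex_cases)
      case 1
      have "c {0, vtx 0 (lterm ! k)} = ?w (lterm ! k) (L k)" if "k \<in> {1, 2, 3}" for k
        using val[of 0 "lterm ! k" "L k"] n term_ok[of k] that by (auto simp: insert_commute)
      moreover obtain k k' where "k \<in> {1, 2, 3}" "k' \<in> {1, 2, 3}" "u = vtx 0 (lterm ! k)" "u' = vtx 0 (lterm ! k')"
        using u 1 by (auto simp: nbrs_0)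
      \<comment> \<open>Strand 1 is deleted, so the two edges are strands 2 and 3.\<close>
      moreover from this have "k \<noteq> 1" "k' \<noteq> 1" "k \<noteq> k'"
        using u e 1 by (auto simp: F_def)
      ultimately show ?thesis using color_table_cap(1) u 1 by auto
    next
      case 2
      have "c {Suc (40 * n), vtx (n - 1) (rterm ! k)} = ?w (rterm ! k) (R k)" if "k \<in> {1, 2, 3}" for k
        using val[of "n - 1" "rterm ! k" "R k"] n term_ok[of k] that by (auto simp: insert_commute)
      moreover obtain k k' where "k \<in> {1, 2, 3}" "k' \<in> {1, 2, 3}"
        "u = vtx (n - 1) (rterm ! k)" "u' = vtx (n - 1) (rterm ! k')"
        using u 2 by (auto simp: nbrs_last)
      moreover from this have "k \<noteq> 1" "k' \<noteq> 1" "k \<noteq> k'"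
        using u e 2 by (auto simp: F_def)
      ultimately show ?thesis using color_table_cap(2) u 2 by auto
    next
      case (3 i j)
      then obtain p q where pq: "p \<in> set (ports j)" "q \<in> set (ports j)"
        "u = target n i p" "u' = target n i q"
        using u by (auto simp: nbrs_vtx)
      then have "p \<noteq> q" using u e(3) by auto
      then have "?w j p \<noteq> ?w j q"
        using verts(1)[OF 3(2)] pq by (auto simp: distinct_map inj_on_def)
      then show ?thesis
        using val[OF 3(1,2) pq(1)] val[OF 3(1,2) pq(2)] u pq 3 by simp
    qed
  qed
  ultimately show "edge_colorable 3 (delete_edges (chain n) F)"
    unfolding edge_colorable_def delete_edges_def by (intro exI[of _ c]) auto
qed

subsection \<open>Small edge cuts\<close>

text \<open>
  The vertices are added one by one to a set \<open>Y\<close>. For \<open>X\<close>, a state records \<open>|X \<inter> Y|\<close> and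
  \<open>|Y - X|\<close>, both capped at 3, and the number of edges inside \<open>Y\<close> cut by \<open>X\<close>. A cut table maps the
  membership in \<open>X\<close> of the frontier, the vertices that still have neighbors outside \<open>Y\<close>, to the
  possible states with fewer than 5 cut edges. It branches on the
  frontier vertices, \<open>False\<close> to the left; a leaf above full depth ignores the remaining ones.
\<close>

datatype cut_table = Leaf "(nat \<times> nat \<times> nat) list" | Node cut_table cut_table

fun look :: "cut_table \<Rightarrow> bool list \<Rightarrow> (nat \<times> nat \<times> nat) list" where
  "look (Leaf S) bs = S"
| "look (Node l r) [] = look l []"
| "look (Node l r) (b # bs) = look (if b then r else l) bs"

fun merge :: "cut_table \<Rightarrow> cut_table \<Rightarrow> cut_table" where
  "merge (Leaf A) (Leaf B) = Leaf (List.union A B)"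
| "merge (Leaf A) (Node l r) = Node (merge (Leaf A) l) (merge (Leaf A) r)"
| "merge (Node l r) (Leaf A) = Node (merge l (Leaf A)) (merge r (Leaf A))"
| "merge (Node l r) (Node l' r') = Node (merge l l') (merge r r')"

fun bump :: "bool \<Rightarrow> nat \<Rightarrow> nat \<times> nat \<times> nat \<Rightarrow> nat \<times> nat \<times> nat" where
  "bump x k (a, b, c) = (if x then (min 3 (Suc a), b, c + k) else (a, min 3 (Suc b), c + k))"

text \<open>The flags say which frontier vertices are neighbors of the new vertex and which remain in the
  frontier.\<close>

fun add_vertex :: "bool \<Rightarrow> nat \<Rightarrow> (bool \<times> bool) list \<Rightarrow> cut_table \<Rightarrow> cut_table" where
  "add_vertex x k [] (Leaf S) = Leaf (filter (\<lambda>(a, b, c). c < 5) (map (bump x k) S))"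
| "add_vertex x k [] (Node l r) = add_vertex x k [] l"
| "add_vertex x k ((nb, keep) # fl) t = (case t of Leaf S \<Rightarrow> 
     (let l' = add_vertex x (if nb \<and> x then Suc k else k) fl (Leaf S);
          r' = add_vertex x (if nb \<and> \<not> x then Suc k else k) fl (Leaf S)
      in if keep then Node l' r' else merge l' r')
   | Node l r \<Rightarrow> (let l' = add_vertex x (if nb \<and> x then Suc k else k) fl l;
          r' = add_vertex x (if nb \<and> \<not> x then Suc k else k) fl r
      in if keep then Node l' r' else merge l' r'))"

fun behind :: "nat \<Rightarrow> port \<Rightarrow> bool" where
  "behind j (I k) \<longleftrightarrow> k < j"
| "behind j (L k) \<longleftrightarrow> True"
| "behind j (R k) \<longleftrightarrow> False"

text \<open>Soundness does not depend on the choice of the vertices that stay in the frontier: forgetting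
  one merely loses the cost of its later edges.\<close>

fun live :: "nat \<Rightarrow> port \<Rightarrow> bool" where
  "live j (I k) \<longleftrightarrow> list_ex (\<lambda>q. case q of I m \<Rightarrow> j < m | L m \<Rightarrow> False | R m \<Rightarrow> True) (ports k)"
| "live j (L k) \<longleftrightarrow> j < lterm ! k"
| "live j (R k) \<longleftrightarrow> False"

definition next_frontier :: "nat \<Rightarrow> port list \<Rightarrow> port list" where
  "next_frontier j fr = (if live j (I j) then [I j] else []) @ filter (live j) fr"

fun plan :: "nat list \<Rightarrow> port list \<Rightarrow> (bool \<times> (bool \<times> bool) list) list" where
  "plan [] fr = []"
| "plan (j # js) fr =
     (live j (I j), map (\<lambda>p. (behind j p \<and> p \<in> set (ports j), live j p)) fr)
       # plan js (next_frontier j fr)"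

text \<open>A vertex kept in the frontier becomes the new root, as it heads
  \<open>next_frontier\<close>; otherwise its two sides are merged.\<close>

fun sweep :: "(bool \<times> (bool \<times> bool) list) list \<Rightarrow> cut_table \<Rightarrow> cut_table" where
  "sweep [] t = t"
| "sweep ((keep, fl) # ps) t = sweep ps ((if keep then Node else merge) (add_vertex False 0 fl t) (add_vertex True 0 fl t))"

definition layer_plan where "layer_plan = plan [0..<40] (map L [0..<5])"
text \<open>At the left end the strands 1, 2, 3 come from the end vertex. The edge joining the strands 0 and 4
  is treated as subdivided by a vertex on the same side of the cut as the left terminal 0.\<close>

definition start_table :: cut_table where
  "start_table =
    (let A = Leaf [(0, 1, 0)]; B = Leaf [(1, 0, 0)]; E = Leaf [];
         N = (\<lambda>z. Node (Node (Node (z A) E) E) (Node E (Node E (z B))))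
     in Node (N (\<lambda>t. Node t E)) (N (\<lambda>t. Node E t)))"


fun sub_table :: "cut_table \<Rightarrow> cut_table \<Rightarrow> bool" where
  "sub_table (Leaf A) (Leaf B) \<longleftrightarrow> list_all (\<lambda>x. x \<in> set B) A"
| "sub_table (Node l r) (Node l' r') \<longleftrightarrow> sub_table l l' \<and> sub_table r r'"
| "sub_table (Leaf A) (Node l r) \<longleftrightarrow> sub_table (Leaf A) l \<and> sub_table (Leaf A) r"
| "sub_table (Node l r) (Leaf B) \<longleftrightarrow> sub_table l (Leaf B) \<and> sub_table r (Leaf B)"

definition right_cap_cost :: "bool \<Rightarrow> bool list \<Rightarrow> nat" where
  "right_cap_cost y bs = of_bool (bs ! 1 \<noteq> y) + of_bool (bs ! 2 \<noteq> y) + of_bool (bs ! 3 \<noteq> y)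
     + of_bool (bs ! 0 \<noteq> bs ! 4)"

text \<open>One vertex per side and 2 edges serve 2-connectivity; three vertices per side and 5
  edges serve cyclic connectivity. \<open>y\<close> is the side of the right end vertex.\<close>

definition final_ok :: "cut_table \<Rightarrow> bool" where
  "final_ok t \<longleftrightarrow> list_all (\<lambda>bs. list_all (\<lambda>y. list_all (\<lambda>s.
     case bump y (right_cap_cost y bs) s of (a, b, c) \<Rightarrow>
       (1 \<le> a \<and> 1 \<le> b \<longrightarrow> 2 \<le> c) \<and> (3 \<le> a \<and> 3 \<le> b \<longrightarrow> 5 \<le> c))
     (look t bs)) [False, True]) (List.n_lists 5 [False, True])"

definition cut_inv :: "(bool \<times> (bool \<times> bool) list) list \<Rightarrow> cut_table" where
  "cut_inv ps = merge start_table (sweep ps start_table)"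

text \<open>\<open>cut_inv\<close> collects the states before and after one layer. Once closed under
  a further sweep, it covers chains of every length.\<close>

definition inv_ok :: "(bool \<times> (bool \<times> bool) list) list \<Rightarrow> bool" where
  "inv_ok ps \<longleftrightarrow> (let t = cut_inv ps in sub_table (sweep ps t) t \<and> final_ok t)"

lemma inv_ok_layer_plan: "inv_ok layer_plan"
  by code_simp

section \<open>Soundness of the dynamic program\<close>

lemma look_merge: "set (look s bs) \<union> set (look t bs) \<subseteq> set (look (merge s t) bs)"
proof (induction s t arbitrary: bs rule: merge.induct)
  case (2 A l r)
  then show ?case by (cases bs) auto
next
  case (3 l r A)
  then show ?case by (cases bs) auto
next
  case (4 l r l' r')
  then show ?case by (cases bs) auto
qed simp

lemma look_sub_table:
  "sub_table s t \<Longrightarrow> set (look s bs) \<subseteq> set (look t bs)"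
proof (induction s t arbitrary: bs rule: sub_table.induct)
  case (1 A B)
  then show ?case by (auto simp: list_all_iff)
next
  case (2 l r l' r')
  then show ?case by (cases bs) auto
next
  case (3 A l r)
  then show ?case by (cases bs) auto
next
  case (4 l r B)
  then show ?case by (cases bs) auto
qed

definition mismatches :: "bool \<Rightarrow> (bool \<times> bool) list \<Rightarrow> bool list \<Rightarrow> nat" where
  "mismatches x fl bs = (\<Sum>(f, v)\<leftarrow>zip fl bs. of_bool (fst f \<and> v \<noteq> x))"

definition kept :: "(bool \<times> bool) list \<Rightarrow> bool list \<Rightarrow> bool list" where
  "kept fl bs = map snd (filter (\<lambda>(f, v). snd f) (zip fl bs))"

text \<open>\<open>k\<close> accumulates the mismatches at the frontier vertices already passed on
  the way down the table.\<close>

lemma look_add_vertex: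
  assumes "s \<in> set (look t bs)" "length bs = length fl"
    "snd (snd s) + k + mismatches x fl bs < 5"
  shows "bump x (k + mismatches x fl bs) s \<in> set (look (add_vertex x k fl t) (kept fl bs))"
  using assms
proof (induction x k fl t arbitrary: bs rule: add_vertex.induct)
  case (1 x k S)
  obtain a b c where "s = (a, b, c)" by (cases s)
  with 1 show ?case
    by (auto simp: mismatches_def kept_def intro: rev_image_eqI[of s])
next
  case (2 x k l r)
  then show ?case by (simp add: mismatches_def kept_def)
next
  case (3 x k nb keep fl t)
  obtain v bs' where bs: "bs = v # bs'" "length bs' = length fl"
    using "3.prems"(2) by (cases bs) auto
  define l where "l = (case t of Leaf S \<Rightarrow> Leaf S | Node l r \<Rightarrow> l)"
  define r where "r = (case t of Leaf S \<Rightarrow> Leaf S | Node l r \<Rightarrow> r)"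
  define l' where "l' = add_vertex x (if nb \<and> x then Suc k else k) fl l"
  define r' where "r' = add_vertex x (if nb \<and> \<not> x then Suc k else k) fl r"
  have t': "add_vertex x k ((nb, keep) # fl) t = (if keep then Node l' r' else merge l' r')"
    by (simp add: l'_def r'_def l_def r_def Let_def split: cut_table.split)
  have m: "mismatches x ((nb, keep) # fl) bs = of_bool (nb \<and> v \<noteq> x) + mismatches x fl bs'"
    by (simp add: mismatches_def bs)
  have s: "s \<in> set (look (if v then r else l) bs')"
    using "3.prems"(1) by (cases t) (auto simp: l_def r_def bs)
  have "bump x (k + mismatches x ((nb, keep) # fl) bs) s \<in> set (look (if v then r' else l') (kept fl bs'))"
    using s "3.prems"(3) bs(2) 3(1-4)
    by (cases t; cases v) (auto simp: m l'_def r'_def l_def r_def split: if_splits)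
  moreover have "set (look (if v then r' else l') (kept fl bs'))
      \<subseteq> set (look (add_vertex x k ((nb, keep) # fl) t) (kept ((nb, keep) # fl) bs))"
    using look_merge[of l' "kept fl bs'" r'] unfolding t' by (auto simp: kept_def bs)
  ultimately show ?case by blast
qed

definition back_cost :: "(port \<Rightarrow> bool) \<Rightarrow> nat \<Rightarrow> nat" where
  "back_cost \<chi> j = (\<Sum>p\<leftarrow>ports j. of_bool (behind j p \<and> \<chi> p \<noteq> \<chi> (I j)))"

lemma sum_list_of_bool: "(\<Sum>x\<leftarrow>xs. of_bool (P x)) = length (filter P xs)"
  by (induction xs) auto

text \<open>Only neighbors in the frontier are counted; underestimating a cut is safe for a lower
  bound.\<close>

lemma mismatches_le_back_cost:
  assumes "distinct fr"
  shows "mismatches (\<chi> (I j)) (map (\<lambda>p. (behind j p \<and> p \<in> set (ports j), live j p)) fr) (map \<chi> fr)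
    \<le> back_cost \<chi> j" (is "?m \<le> _")
proof -
  let ?P = "\<lambda>p. behind j p \<and> \<chi> p \<noteq> \<chi> (I j)"
  have "?m = (\<Sum>p\<leftarrow>fr. of_bool (p \<in> set (ports j) \<and> ?P p))"
    by (simp add: mismatches_def zip_map_map zip_same_conv_map comp_def conj_ac)
  also have "\<dots> = length (filter (\<lambda>p. p \<in> set (ports j) \<and> ?P p) fr)"
    by (rule sum_list_of_bool)
  also have "\<dots> = card (set (filter (\<lambda>p. p \<in> set (ports j) \<and> ?P p) fr))"
    using assms by (intro distinct_card[symmetric]) simp
  also have "\<dots> \<le> card (set (filter ?P (ports j)))"
    by (intro card_mono) auto
  also have "\<dots> \<le> length (filter ?P (ports j))"
    by (rule card_length)
  also have "\<dots> = back_cost \<chi> j"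
    by (simp only: back_cost_def sum_list_of_bool)
  finally show ?thesis .
qed

text \<open>The total below 5 guarantees that the filter in \<open>add_vertex\<close> never discards
  the state of \<open>\<chi>\<close>. The recorded cost may be smaller than the true one.\<close>

lemma look_sweep:
  assumes "(min 3 a, min 3 b, c) \<in> set (look t (map \<chi> fr))"
    and "distinct fr" "distinct js" "\<forall>j\<in>set js. I j \<notin> set fr"
    and "c + (\<Sum>j\<leftarrow>js. back_cost \<chi> j) < 5"
  shows "\<exists>c' \<le> c + (\<Sum>j\<leftarrow>js. back_cost \<chi> j).
    (min 3 (a + length (filter (\<lambda>j. \<chi> (I j)) js)),
     min 3 (b + length (filter (\<lambda>j. \<not> \<chi> (I j)) js)), c')
    \<in> set (look (sweep (plan js fr) t) (map \<chi> (fold next_frontier js fr)))"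
  using assms
proof (induction js arbitrary: a b c t fr)
  case (Cons j js)
  let ?x = "\<chi> (I j)"
  let ?fl = "map (\<lambda>p. (behind j p \<and> p \<in> set (ports j), live j p)) fr"
  let ?t = "(if live j (I j) then Node else merge) (add_vertex False 0 ?fl t) (add_vertex True 0 ?fl t)"
  define m where "m = mismatches ?x ?fl (map \<chi> fr)"
  have m: "m \<le> back_cost \<chi> j"
    unfolding m_def using Cons.prems(2) by (rule mismatches_le_back_cost)
  have kept: "kept ?fl (map \<chi> fr) = map \<chi> (filter (live j) fr)"
    by (simp add: kept_def zip_map_map zip_same_conv_map filter_map comp_def)
  have "bump ?x m (min 3 a, min 3 b, c)
      \<in> set (look (add_vertex ?x 0 ?fl t) (map \<chi> (filter (live j) fr)))"
    using look_add_vertex[OF Cons.prems(1), of ?fl 0 ?x] Cons.prems(5) m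
    by (simp add: kept m_def)
  also have "\<dots> \<subseteq> set (look ?t (map \<chi> (next_frontier j fr)))"
    using look_merge[of "add_vertex False 0 ?fl t" "map \<chi> (filter (live j) fr)" "add_vertex True 0 ?fl t"]
    by (cases ?x) (auto simp: next_frontier_def)
  also have "bump ?x m (min 3 a, min 3 b, c)
      = (min 3 (a + of_bool ?x), min 3 (b + of_bool (\<not> ?x)), c + m)"
    by auto
  finally have "(min 3 (a + of_bool ?x), min 3 (b + of_bool (\<not> ?x)), c + m)
      \<in> set (look ?t (map \<chi> (next_frontier j fr)))" .
  moreover have "distinct (next_frontier j fr)" "\<forall>i\<in>set js. I i \<notin> set (next_frontier j fr)"
    using Cons.prems(2-4) by (auto simp: next_frontier_def)
  moreover have "c + m + (\<Sum>j\<leftarrow>js. back_cost \<chi> j) < 5"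
    using Cons.prems(5) m by simp
  ultimately obtain c' where c': "c' \<le> c + m + (\<Sum>j\<leftarrow>js. back_cost \<chi> j)"
    "(min 3 (a + of_bool ?x + length (filter (\<lambda>j. \<chi> (I j)) js)),
     min 3 (b + of_bool (\<not> ?x) + length (filter (\<lambda>j. \<not> \<chi> (I j)) js)), c')
    \<in> set (look (sweep (plan js (next_frontier j fr)) ?t) (map \<chi> (fold next_frontier js (next_frontier j fr))))"
    using Cons.IH[of "a + of_bool ?x" "b + of_bool (\<not> ?x)" "c + m" ?t "next_frontier j fr"] Cons.prems(3)
    by auto
  show ?case
    using c' m by (intro exI[of _ c']) (auto split: if_splits)
qed auto

text \<open>New vertices go in front, so the right terminals end up in decreasing order.
  \<open>rterm\<close> lists the strands in this order, so the final frontier lines up with the left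
  strands of the next layer.\<close>

lemma last_frontier: "fold next_frontier [0..<40] (map L [0..<5]) = map I rterm"
  by code_simp

text \<open>A left strand takes the side of the vertex that it comes from. In the first layer
  strands 0 and 4 come from the imagined subdividing vertex on the side of terminal 0.\<close>

fun pattern :: "nat set \<Rightarrow> nat \<Rightarrow> port \<Rightarrow> bool" where
  "pattern X i (I j) \<longleftrightarrow> vtx i j \<in> X"
| "pattern X i (L k) \<longleftrightarrow>
    (if i = 0 then (if k = 0 \<or> k = 4 then vtx 0 (lterm ! 0) else 0) else vtx (i - 1) (rterm ! k)) \<in> X"
| "pattern X i (R k) \<longleftrightarrow> False"

text \<open>Edges are charged to their larger end. The edge joining strands 0 and 4 is charged at
  the left end to vertex 9 through \<open>L 4\<close>, at the right end to vertex 39 through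
  \<open>R 0\<close>, which gives the extra term.\<close>

lemma cut_port_cost:
  assumes n: "i < n" "j < 40" and p: "p \<in> set (ports j)"
  shows "of_bool (target n i p < vtx i j \<and> (target n i p \<in> X) \<noteq> (vtx i j \<in> X)) =
    of_bool (behind j p \<and> pattern X i p \<noteq> pattern X i (I j)) +
    (if Suc i = n \<and> p = R 0 then of_bool ((vtx i (rterm ! 0) \<in> X) \<noteq> (vtx i (rterm ! 4) \<in> X)) else (0 :: nat))"
proof (cases p)
  case (I k)
  then show ?thesis by (auto simp: vtx_def)
next
  case (L k)
  then have k: "k < 5" "j = lterm ! k" using ports_L[OF n(2), of k] p by auto
  have "vtx (i - 1) (rterm ! k) < vtx i j" if "i \<noteq> 0"
    using that term_ok(3)[OF k(1)] by (auto simp: vtx_def)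
  then show ?thesis using L k by (auto simp: vtx_def lterm_def)
next
  case (R k)
  then have k: "k < 5" "j = rterm ! k" using ports_R[OF n(2), of k] p by auto
  have "\<not> vtx (Suc i) (lterm ! k) < vtx i j" using n by (auto simp: vtx_def)
  moreover have "\<not> Suc (40 * n) < vtx i j" using vtx_less[OF n] by simp
  ultimately show ?thesis using R k by (auto simp: vtx_def rterm_def)
qed

section \<open>Edge cuts of the whole chain\<close>

lemma sum_blocks:
  fixes g :: "nat \<Rightarrow> nat"
  shows "(\<Sum>m<40 * n. g m) = (\<Sum>i<n. \<Sum>j<40. g (40 * i + j))"
proof -
  have "(\<Sum>m<40 * n. g m) = (\<Sum>i<n. sum g {i * 40..<i * 40 + 40})"
    using sum.nat_group[of g 40 n] by (simp add: mult.commute)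
  also have "\<dots> = (\<Sum>i<n. \<Sum>j<40. g (40 * i + j))"
  proof (rule sum.cong)
    fix i
    show "sum g {i * 40..<i * 40 + 40} = (\<Sum>j<40. g (40 * i + j))"
      using sum.shift_bounds_nat_ivl[of g 0 "i * 40" 40]
      by (simp add: atLeast0LessThan ac_simps)
  qed simp
  finally show ?thesis .
qed

definition layer_cost :: "nat set \<Rightarrow> nat \<Rightarrow> nat" where
  "layer_cost X i = (\<Sum>j\<leftarrow>[0..<40]. back_cost (pattern X i) j)"

definition left_pattern :: "nat set \<Rightarrow> nat \<Rightarrow> bool list" where
  "left_pattern X i = map (pattern X i) (map L [0..<5])"

lemma card_edge_boundary_chain:
  assumes "1 \<le> n"
  shows "(\<Sum>i<n. layer_cost X i) + right_cap_cost (Suc (40 * n) \<in> X) (left_pattern X n)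
    \<le> card (edge_boundary (chain n) X)"
proof -
  interpret cubic_nbrs "{..Suc (40 * n)}" "nbrs n" using assms by (rule cubic_nbrs_chain)
  define b where "b v = (\<Sum>u\<leftarrow>nbrs n v. of_bool (u < v \<and> (u \<in> X) \<noteq> (v \<in> X)) :: nat)" for v
  \<comment> \<open>The joining edge at the right end is charged within the last layer, but belongs
    to \<open>right_cap_cost\<close>.\<close>
  define z where "z = (of_bool ((vtx (n - 1) (rterm ! 0) \<in> X) \<noteq> (vtx (n - 1) (rterm ! 4) \<in> X)) :: nat)"
  have layer: "layer_cost X i + (if Suc i = n then z else 0) \<le> (\<Sum>j<40. b (vtx i j))"
    if "i < n" for i
  proof -
    have b: "b (vtx i j) = back_cost (pattern X i) j
        + (\<Sum>p\<leftarrow>ports j. if Suc i = n \<and> p = R 0 then z else 0)" if j: "j < 40" for j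
    proof -
      have "b (vtx i j) = (\<Sum>p\<leftarrow>ports j. of_bool (target n i p < vtx i j \<and>
          (target n i p \<in> X) \<noteq> (vtx i j \<in> X)))"
        by (simp add: b_def nbrs_vtx[OF \<open>i < n\<close> j] comp_def)
      also have "\<dots> = (\<Sum>p\<leftarrow>ports j. of_bool (behind j p \<and> pattern X i p \<noteq> pattern X i (I j)) +
          (if Suc i = n \<and> p = R 0 then z else 0))"
        using cut_port_cost[OF \<open>i < n\<close> j] by (intro arg_cong[of _ _ sum_list] map_cong) (auto simp: z_def)
      finally show ?thesis by (simp add: back_cost_def sum_list_addf)
    qed
    have "(if Suc i = n then z else 0) \<le> (\<Sum>p\<leftarrow>ports (rterm ! 0). if Suc i = n \<and> p = R 0 then z else 0)"
      using term_ok(4)[of 0] by (intro member_le_sum_list) (force simp: image_iff, simp)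
    also have "\<dots> \<le> (\<Sum>j<40. \<Sum>p\<leftarrow>ports j. if Suc i = n \<and> p = R 0 then z else 0)"
      using term_ok(3)[of 0] by (intro member_le_sum) auto
    finally have "(if Suc i = n then z else 0) \<le> (\<Sum>j<40. \<Sum>p\<leftarrow>ports j. if Suc i = n \<and> p = R 0 then z else 0)" .
    moreover have "layer_cost X i = (\<Sum>j<40. back_cost (pattern X i) j)"
      by (simp add: layer_cost_def interv_sum_list_conv_sum_set_nat atLeast0LessThan del: upt_rec_numeral)
    moreover have "(\<Sum>j<40. b (vtx i j)) = (\<Sum>j<40. back_cost (pattern X i) j
        + (\<Sum>p\<leftarrow>ports j. if Suc i = n \<and> p = R 0 then z else 0))"
      by (intro sum.cong) (simp_all add: b)
    ultimately show ?thesis by (simp add: sum.distrib)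
  qed
  have y: "right_cap_cost (Suc (40 * n) \<in> X) (left_pattern X n) \<le> b (Suc (40 * n)) + z"
  proof -
    have "vtx (n - 1) (rterm ! k) < Suc (40 * n)" if "k < 5" for k
      using assms that term_ok by (intro vtx_less) auto
    from this[of 1] this[of 2] this[of 3] show ?thesis
      using assms by (simp add: right_cap_cost_def left_pattern_def b_def nbrs_def z_def numeral_2_eq_2
          del: upt_rec_numeral)
  qed
  have "(\<Sum>i<n. layer_cost X i) + z = (\<Sum>i<n. layer_cost X i + (if Suc i = n then z else 0))"
  proof -
    have "(\<Sum>i<n. if Suc i = n then z else 0) = (\<Sum>i<n. if i = n - 1 then z else 0)"
      using assms by (intro sum.cong) auto
    then show ?thesis using assms by (simp add: sum.distrib)
  qed
  also have "\<dots> \<le> (\<Sum>i<n. \<Sum>j<40. b (vtx i j))"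
    using layer by (intro sum_mono) auto
  also have "\<dots> = (\<Sum>m<40 * n. b (Suc m))"
    by (simp add: sum_blocks vtx_def)
  finally have "(\<Sum>i<n. layer_cost X i) + z \<le> (\<Sum>m<40 * n. b (Suc m))" .
  moreover have "card (edge_boundary (chain n) X) = b 0 + (\<Sum>m<40 * n. b (Suc m)) + b (Suc (40 * n))"
  proof -
    have "card (edge_boundary (chain n) X) = (\<Sum>v\<le>Suc (40 * n). b v)"
      by (simp add: chain_def card_edge_boundary b_def)
    also have "\<dots> = b 0 + (\<Sum>m\<le>40 * n. b (Suc m))"
      by (rule sum.atMost_Suc_shift)
    finally show ?thesis by (simp add: lessThan_Suc_atMost[symmetric])
  qed
  ultimately show ?thesis using y by simp
qed

lemma look_start_table:
  "(of_bool x, of_bool (\<not> x), 0) \<in> set (look start_table [z, x, x, x, z])"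
  by (cases x; cases z) (simp_all add: start_table_def Let_def)

lemma initial_segment_Suc: "{..40 * Suc i} = {..40 * i} \<union> vtx i ` {..<40}"
proof -
  have "m \<in> vtx i ` {..<40}" if "40 * i < m" "m \<le> 40 * Suc i" for m
    using that by (intro image_eqI[of _ _ "m - Suc (40 * i)"]) (auto simp: vtx_def)
  then have "{..40 * Suc i} \<subseteq> {..40 * i} \<union> vtx i ` {..<40}"
    by (metis UnI1 UnI2 atMost_iff not_le subsetI)
  then show ?thesis by (auto simp: vtx_def)
qed

lemma card_segment_Suc:
  "card {v \<in> {..40 * Suc i}. P v} = card {v \<in> {..40 * i}. P v} + length (filter (\<lambda>j. P (vtx i j)) [0..<40])"
proof -
  let ?S = "{j \<in> {..<40}. P (vtx i j)}"
  have "{v \<in> {..40 * Suc i}. P v} = {v \<in> {..40 * i}. P v} \<union> vtx i ` ?S"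
    unfolding initial_segment_Suc by auto
  moreover have "card \<dots> = card {v \<in> {..40 * i}. P v} + card (vtx i ` ?S)"
    by (intro card_Un_disjoint) (auto simp: vtx_def)
  moreover have "card (vtx i ` ?S) = card ?S"
    by (intro card_image) (auto simp: inj_on_def vtx_def)
  moreover have "card ?S = length (filter (\<lambda>j. P (vtx i j)) [0..<40])"
    by (subst distinct_card[symmetric]) (auto simp del: upt_rec_numeral intro!: arg_cong[of _ _ card])
  ultimately show ?thesis by simp
qed

text \<open>\<open>look_sweep\<close> carries the state of \<open>X\<close> through one layer, and
  closure under the sweep returns it to the same table.\<close>

lemma look_cut_inv:
  assumes "(\<Sum>i'<i. layer_cost X i') < 5"
  shows "\<exists>c \<le> (\<Sum>i'<i. layer_cost X i').
    (min 3 (card {v \<in> {..40 * i}. v \<in> X}), min 3 (card {v \<in> {..40 * i}. v \<notin> X}), c)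
    \<in> set (look (cut_inv layer_plan) (left_pattern X i))"
  using assms
proof (induction i)
  case 0
  have "left_pattern X 0 = [vtx 0 (lterm ! 0) \<in> X, 0 \<in> X, 0 \<in> X, 0 \<in> X, vtx 0 (lterm ! 0) \<in> X]"
    by (simp add: left_pattern_def upt_rec)
  moreover have "{v \<in> {..0}. v \<in> X} = (if 0 \<in> X then {0} else {})"
    "{v \<in> {..0}. v \<notin> X} = (if 0 \<in> X then {} else {0})"
    by (auto intro: gr0I)
  ultimately show ?case
    using look_start_table[of "0 \<in> X" "vtx 0 (lterm ! 0) \<in> X"]
      look_merge[of start_table "left_pattern X 0" "sweep layer_plan start_table"]
    by (auto simp: cut_inv_def min_def split: if_splits)
next
  case (Suc i)
  then obtain c where c: "c \<le> (\<Sum>i'<i. layer_cost X i')"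
    "(min 3 (card {v \<in> {..40 * i}. v \<in> X}), min 3 (card {v \<in> {..40 * i}. v \<notin> X}), c)
    \<in> set (look (cut_inv layer_plan) (left_pattern X i))" by auto
  have pat: "map (pattern X i) (map I rterm) = left_pattern X (Suc i)"
    by (simp add: left_pattern_def rterm_def upt_rec)
  have dist: "distinct (map L [0..<5])" "distinct [0..<40]" "\<forall>j\<in>set [0..<40]. I j \<notin> set (map L [0..<5])"
    by (auto simp: distinct_map inj_on_def simp del: upt_rec_numeral)
  have cost: "c + (\<Sum>j\<leftarrow>[0..<40]. back_cost (pattern X i) j) < 5"
    using Suc.prems c(1) by (simp add: layer_cost_def[symmetric])
  obtain c' where c': "c' \<le> c + layer_cost X i"
    "(min 3 (card {v \<in> {..40 * Suc i}. v \<in> X}), min 3 (card {v \<in> {..40 * Suc i}. v \<notin> X}), c')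
      \<in> set (look (sweep layer_plan (cut_inv layer_plan)) (left_pattern X (Suc i)))"
    using look_sweep[OF c(2)[unfolded left_pattern_def] dist cost]
    unfolding last_frontier pat card_segment_Suc layer_cost_def[symmetric] layer_plan_def[symmetric]
      pattern.simps
    by blast
  moreover have "sub_table (sweep layer_plan (cut_inv layer_plan)) (cut_inv layer_plan)"
    using inv_ok_layer_plan by (simp add: inv_ok_def Let_def)
  ultimately show ?case
    using look_sub_table c(1) by (intro exI[of _ c']) (auto simp del: upt_rec_numeral)
qed

lemma final_okD:
  fixes y :: bool
  assumes "final_ok t" "length bs = 5" "(a, b, c) \<in> set (look t bs)"
  defines "a' \<equiv> min 3 (a + of_bool y)" and "b' \<equiv> min 3 (b + of_bool (\<not> y))"
    and "c' \<equiv> c + right_cap_cost y bs"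
  assumes "a \<le> 3" "b \<le> 3"
  shows "1 \<le> a' \<Longrightarrow> 1 \<le> b' \<Longrightarrow> 2 \<le> c'" and "3 \<le> a' \<Longrightarrow> 3 \<le> b' \<Longrightarrow> 5 \<le> c'"
proof -
  have "bs \<in> set (List.n_lists 5 [False, True])"
    using assms(2) by (auto simp: set_n_lists)
  then have "\<forall>s\<in>set (look t bs). case bump y (right_cap_cost y bs) s of (a, b, c) \<Rightarrow>
       (1 \<le> a \<and> 1 \<le> b \<longrightarrow> 2 \<le> c) \<and> (3 \<le> a \<and> 3 \<le> b \<longrightarrow> 5 \<le> c)"
    using assms(1) by (cases y) (simp_all add: final_ok_def list_all_iff)
  moreover have "bump y (right_cap_cost y bs) (a, b, c) = (a', b', c')"
    using assms(7,8) by (auto simp: a'_def b'_def c'_def)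
  ultimately show "1 \<le> a' \<Longrightarrow> 1 \<le> b' \<Longrightarrow> 2 \<le> c'" "3 \<le> a' \<Longrightarrow> 3 \<le> b' \<Longrightarrow> 5 \<le> c'"
    using assms(3) by force+
qed

lemma chain_edge_boundary:
  assumes "1 \<le> n" "X \<subseteq> {..Suc (40 * n)}"
  shows "X \<noteq> {} \<Longrightarrow> X \<noteq> {..Suc (40 * n)} \<Longrightarrow> 2 \<le> card (edge_boundary (chain n) X)" (is "?P \<Longrightarrow> ?Q \<Longrightarrow> _")
    and "3 \<le> card X \<Longrightarrow> 3 \<le> card ({..Suc (40 * n)} - X) \<Longrightarrow> 5 \<le> card (edge_boundary (chain n) X)"
      (is "?R \<Longrightarrow> ?S \<Longrightarrow> _")
proof -
  let ?y = "Suc (40 * n) \<in> X"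
  define a where "a = card {v \<in> {..40 * n}. v \<in> X}"
  define b where "b = card {v \<in> {..40 * n}. v \<notin> X}"
  have finX: "finite X" using assms(2) finite_subset by blast
  have "X = {v \<in> {..40 * n}. v \<in> X} \<union> (if ?y then {Suc (40 * n)} else {})"
    using assms(2) by (auto simp: le_Suc_eq)
  moreover have "card \<dots> = a + of_bool ?y"
    unfolding a_def by (subst card_Un_disjoint) auto
  ultimately have a: "card X = a + of_bool ?y" by simp
  have "{..Suc (40 * n)} - X = {v \<in> {..40 * n}. v \<notin> X} \<union> (if ?y then {} else {Suc (40 * n)})"
    by (auto simp: le_Suc_eq)
  moreover have "card \<dots> = b + of_bool (\<not> ?y)"
    unfolding b_def by (subst card_Un_disjoint) auto
  ultimately have b: "card ({..Suc (40 * n)} - X) = b + of_bool (\<not> ?y)" by simp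
  have main: "(1 \<le> card X \<longrightarrow> 1 \<le> card ({..Suc (40 * n)} - X) \<longrightarrow> 2 \<le> card (edge_boundary (chain n) X)) \<and>
    (?R \<longrightarrow> ?S \<longrightarrow> 5 \<le> card (edge_boundary (chain n) X))"
  \<comment> \<open>If the layers alone contribute 5 cut edges, both bounds hold; otherwise the
    table contains the state of \<open>X\<close> and \<open>final_ok\<close> applies.\<close>
  proof (cases "(\<Sum>i<n. layer_cost X i) < 5")
    case True
    then obtain c where c: "c \<le> (\<Sum>i<n. layer_cost X i)"
      "(min 3 a, min 3 b, c) \<in> set (look (cut_inv layer_plan) (left_pattern X n))"
      using look_cut_inv[of X n] by (auto simp: a_def b_def)
    have le: "c + right_cap_cost ?y (left_pattern X n) \<le> card (edge_boundary (chain n) X)"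
      using card_edge_boundary_chain[OF assms(1), of X] c(1) by simp
    have "final_ok (cut_inv layer_plan)"
      using inv_ok_layer_plan by (simp add: inv_ok_def Let_def)
    moreover have "length (left_pattern X n) = 5" by (simp add: left_pattern_def del: upt_rec_numeral)
    ultimately have "1 \<le> min 3 (min 3 a + of_bool ?y) \<Longrightarrow> 1 \<le> min 3 (min 3 b + of_bool (\<not> ?y)) \<Longrightarrow>
        2 \<le> c + right_cap_cost ?y (left_pattern X n)"
      "3 \<le> min 3 (min 3 a + of_bool ?y) \<Longrightarrow> 3 \<le> min 3 (min 3 b + of_bool (\<not> ?y)) \<Longrightarrow>
        5 \<le> c + right_cap_cost ?y (left_pattern X n)"
      using final_okD[OF _ _ c(2), of ?y] by auto
    then show ?thesis using le a b by (auto split: if_splits)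
  next
    case False
    then show ?thesis using card_edge_boundary_chain[OF assms(1), of X] by simp
  qed
  { assume ?P ?Q
    then have "1 \<le> card X" "1 \<le> card ({..Suc (40 * n)} - X)"
      using finX assms(2) by (auto simp: Suc_le_eq card_gt_0_iff)
    with main show "2 \<le> card (edge_boundary (chain n) X)" by blast }
  { assume ?R ?S
    with main show "5 \<le> card (edge_boundary (chain n) X)" by blast }
qed

theorem theorem1:
  fixes n :: nat
  assumes "n \<ge> 1"
  shows "\<exists>H :: nat ugraph. snark H \<and> cyclically_edge_connected 5 H \<and>
           card (verts H) = 40 * n + 2 \<and> resistance H = 2 \<and> flow_resistance H = n"
proof -
  interpret cubic_nbrs "{..Suc (40 * n)}" "nbrs n" using assms by (rule cubic_nbrs_chain)
  let ?H = "chain n"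
  have H: "simple_graph ?H" "cubic ?H" "verts ?H = {..Suc (40 * n)}"
    using simple cubic by (simp_all add: chain_def)
  have fin: "finite (edges ?H)" using H(1) by (rule simple_graph_finite_edges)
  have no_flow: "\<not> nowhere_zero ?H f" if "is_flow ?H f" for f
  proof
    assume "nowhere_zero ?H f"
    then have none: "{e \<in> edges ?H. f e = 0} = {}" by (auto simp: nowhere_zero_def)
    show False using chain_flow_zeros[OF assms that, unfolded none] assms by simp
  qed
  have card_pair: "card {a, b} \<le> 2" for a b :: "nat set"
    by (simp add: card_insert_if)
  have "vertex_connected 2 ?H"
    using H chain_edge_boundary(1)[OF assms] assms by (intro vertex_connected_2I) auto
  moreover have "\<not> edge_colorable 3 ?H"
    using H(1,2) no_flow by (rule not_edge_colorableI)
  moreover have "cyclically_edge_connected 5 ?H"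
    using H(3) chain_edge_boundary(2)[OF assms] by (intro cyclically_5_edge_connectedI) auto
  moreover have "resistance ?H = 2"
    by (rule resistance_eq_2I[OF H(1,2) no_flow chain_coloring(1)[OF assms] card_pair
          chain_coloring(2)[OF assms]])
  moreover have "flow_resistance ?H = n"
    using fin chain_flow_zeros[OF assms] chain_flow[OF assms] by (rule flow_resistance_eqI)
  ultimately show ?thesis using H by (intro exI[of _ ?H]) (auto simp: snark_def)
qed

end
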